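(* Let $E$ be a real normed linear space, let $F:E\to E$ be a homeomorphism with global attractor $\mathbb{A}$, and let $k$ be a non-negative integer with $\dim(\mathbb{A})\le k$. Then for any $\epsilon>0$ there exist a set $A\subset\mathbb{R}^{4k+4}$, a homeomorphism $e:\mathbb{A}\to A$, and a homeomorphism $f:\mathbb{R}^{4k+4}\to\mathbb{R}^{4k+4}$ such that the dynamics on $\mathbb{A}$ and $A$ are conjugate under $e$, i.e. $f(A)=A$ and $$F|_{\mathbb{A}}=e^{-1}\circ f\circ e,$$ and $f$ has a global attractor $A_f$ with $$A\subset A_f\subset N(A,\epsilon),$$ where $N(A,\epsilon)=\{y\in\mathbb{R}^{4k+4}:\ \operatorname{dist}(y,A)<\epsilon\}$.
   Context: $\dim$ denotes topological (Lebesgue covering) dimension. For subsets $A,B$ of a normed space, $\operatorname{dist}(A,B)=\sup_{a\in A}\inf_{b\in B}\|a-b\|$, and $\operatorname{dist}(y,A)=\inf_{a\in A}\|y-a\|$. A set $\mathbb{A}$ is a global attractor for a continuous map $F:E\to E$ on a normed space $E$ if (1) $\mathbb{A}$ is compact; (2) $F(\mathbb{A})=\mathbb{A}$; (3) for every bounded $B\subset E$, $\operatorname{dist}(F^n(B),\mathbb{A})\to0$ as $n\to\infty$. If it exists, it is unique. $\mathbb{R}^{4k+4}$ carries the Euclidean norm. *)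

theory Defs
  imports "HOL-Analysis.Analysis"
begin

(* Every finite open cover of X has a finite open refinement such that no point lies in
   more than m of its members. *)
definition refinements_of_order_le :: "'a topology \<Rightarrow> nat \<Rightarrow> bool" where
  "refinements_of_order_le X m \<longleftrightarrow>
     (\<forall>\<U>. finite \<U> \<and> (\<forall>U\<in>\<U>. openin X U) \<and> \<Union>\<U> = topspace X \<longrightarrow>
        (\<exists>\<V>. finite \<V> \<and> (\<forall>V\<in>\<V>. openin X V) \<and> \<Union>\<V> = topspace X \<and>
             (\<forall>V\<in>\<V>. \<exists>U\<in>\<U>. V \<subseteq> U) \<and>
             (\<forall>x\<in>topspace X. card {V\<in>\<V>. x \<in> V} \<le> m)))"

(* Lebesgue covering dimension: at most n iff refinements of order n + 1 exist. The value is
   -1 for the empty space (m = 0), and infinity if no m works (infimum of the empty set). *)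
definition covering_dim :: "'a topology \<Rightarrow> ereal" where
  "covering_dim X = (INF m\<in>{m. refinements_of_order_le X m}. ereal (real m - 1))"

(* Valued in ennreal, because the first argument may be unbounded: a continuous map on an
   infinite-dimensional space need not map bounded sets to bounded sets. The infimum over the
   empty set is infinity, so the empty set attracts no nonempty set. *)
definition semidist :: "'a::real_normed_vector set \<Rightarrow> 'a set \<Rightarrow> ennreal" where
  "semidist A B = (SUP a\<in>A. INF b\<in>B. ennreal (norm (a - b)))"

definition global_attractor :: "('a::real_normed_vector \<Rightarrow> 'a) \<Rightarrow> 'a set \<Rightarrow> bool" where
  "global_attractor F \<A> \<longleftrightarrow>
     continuous_on UNIV F \<and> compact \<A> \<and> F ` \<A> = \<A> \<and>
     (\<forall>B. bounded B \<longrightarrow> (\<lambda>n. semidist ((F ^^ n) ` B) \<A>) \<longlonglongrightarrow> 0)"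

(* infdist is 0 for the empty set; only nonempty A is of interest here. *)
definition nbhd :: "'a::real_normed_vector set \<Rightarrow> real \<Rightarrow> 'a set" where
  "nbhd A \<epsilon> = {y. infdist y A < \<epsilon>}"

end

theory Submission
  imports Defs
begin

text \<open>
  The attractor embeds in \<open>\<real>\<^bsup>2k+2\<^esup>\<close> by the Menger--Noebeling theorem, and Klee's trick in
  \<open>\<real>\<^bsup>2k+2\<^esup> \<times> \<real>\<^bsup>2k+2\<^esup>\<close> extends the embedded dynamics to a homeomorphism \<open>\<phi>\<close> that displaces
  norms by a bounded amount. The attractor is contractible in each of its neighbourhoods: contract
  its convex hull linearly to a point, and conjugate with a high iterate of \<open>F\<close>. With the second
  factor keeping points apart, such a contraction is realised by an ambient homeomorphism \<open>\<Theta>\<close>,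
  supported near the embedded copy \<open>A\<close>, that squeezes \<open>A\<close> into a small ball \<open>B\<close>. If \<open>\<psi>\<close> is the
  identity on \<open>B\<close> and contracts its complement strongly towards \<open>B\<close>, then
  \<open>f = \<phi> \<circ> \<Theta>\<inverse> \<circ> \<psi> \<circ> \<Theta>\<close> agrees with \<open>\<phi>\<close> on \<open>A\<close> and maps a huge ball into a neighbourhood of \<open>A\<close>,
  while it at least halves the norm outside that ball.
\<close>

subsection \<open>Ambient homeomorphisms\<close>

text \<open>Adding \<open>g z\<close> keeps every point in its fibre of \<open>Q\<close>. On a fibre
  \<open>g\<close> is a contraction, which gives injectivity, and \<open>y - g x\<close> as a
  function of \<open>x\<close> has a Banach fixed point, which gives surjectivity. Continuity of the
  inverse is invariance of domain.\<close>

lemma shear_homeomorphism: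
  fixes g Q :: "'b::euclidean_space \<Rightarrow> 'b"
  assumes Q: "linear Q" and cont: "continuous_on UNIV g" and Qg: "\<And>z. Q (g z) = 0"
    and c: "c < 1" and lip: "\<And>z z'. Q z = Q z' \<Longrightarrow> norm (g z - g z') \<le> c * norm (z - z')"
  obtains h where "homeomorphism UNIV UNIV (\<lambda>z. z + g z) h"
proof -
  have Qadd: "Q (z + g z) = Q z" for z
    using Q Qg by (simp add: linear_add)
  have inj: "inj (\<lambda>z. z + g z)"
  proof (rule injI)
    fix z z' assume eq: "z + g z = z' + g z'"
    then have "Q z = Q z'"
      by (metis Qadd)
    then have "norm (g z - g z') \<le> c * norm (z - z')"
      by (rule lip)
    moreover have "norm (g z - g z') = norm (z - z')"
    proof -
      have "g z - g z' = z' - z" using eq by (simp add: algebra_simps)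
      then show ?thesis by (simp add: norm_minus_commute)
    qed
    ultimately have "(1 - c) * norm (z - z') \<le> 0"
      by (simp add: algebra_simps)
    then show "z = z'"
      using c by (simp add: mult_le_0_iff)
  qed
  have "y \<in> range (\<lambda>z. z + g z)" for y
  proof -
    let ?s = "{x. Q x = Q y}"
    have "closed ?s"
      using linear_continuous_on[OF linear_conv_bounded_linear[THEN iffD1, OF Q], of UNIV]
      by (intro closed_Collect_eq) auto
    then have "complete ?s" by (simp add: complete_eq_closed)
    moreover have "?s \<noteq> {}" by auto
    moreover have "(\<lambda>x. y - g x) ` ?s \<subseteq> ?s"
      using Q Qg by (auto simp: linear_diff)
    \<comment> \<open>The hypothesis admits negative \<open>c\<close>, whereas the fixed point
      theorem wants a nonnegative constant.\<close>
    moreover have "\<forall>x\<in>?s. \<forall>x'\<in>?s. dist (y - g x) (y - g x') \<le> max c 0 * dist x x'"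
    proof (intro ballI)
      fix x x' assume "x \<in> ?s" "x' \<in> ?s"
      then have "norm (g x - g x') \<le> c * norm (x - x')"
        by (intro lip) auto
      also have "\<dots> \<le> max c 0 * norm (x - x')"
        by (intro mult_right_mono) auto
      finally show "dist (y - g x) (y - g x') \<le> max c 0 * dist x x'"
        by (simp add: dist_norm norm_minus_commute)
    qed
    ultimately have "\<exists>!x\<in>?s. y - g x = x"
      using c by (intro Banach_fix[of ?s "max c 0"]) auto
    then obtain x where "y - g x = x" by blast
    then have "y = x + g x" by (simp add: diff_eq_eq)
    then show ?thesis by (rule image_eqI) simp
  qed
  then have surj: "range (\<lambda>z. z + g z) = UNIV"
    by blast
  have "continuous_on UNIV (\<lambda>z. z + g z)"
    by (intro continuous_intros cont)
  then obtain h where "homeomorphism UNIV (range (\<lambda>z. z + g z)) (\<lambda>z. z + g z) h"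
    using invariance_of_domain_homeomorphism[of UNIV "\<lambda>z. z + g z"] inj by auto
  then show ?thesis
    unfolding surj by (rule that)
qed

text \<open>This is one short step of an isotopy. The \<open>Q\<close>-part of \<open>b0 x\<close>
  determines \<open>x\<close> and is not changed, so the displacement is a function of the
  \<open>Q\<close>-part alone. Extended by Tietze and cut off at distance \<open>d\<close> from the
  image of \<open>b0\<close>, it becomes a shear along the fibres of \<open>Q\<close>.\<close>

lemma push_homeomorphism:
  fixes b0 b1 :: "'a::metric_space \<Rightarrow> 'b::euclidean_space"
  assumes X: "compact X" "X \<noteq> {}" and b0: "continuous_on X b0" and b1: "continuous_on X b1"
    and Q: "linear Q" and QQ: "\<And>z. Q (Q z) = Q z" and normQ: "\<And>z. norm (z - Q z) \<le> norm z"
    and inj: "inj_on (\<lambda>x. Q (b0 x)) X" and Qeq: "\<And>x. x \<in> X \<Longrightarrow> Q (b1 x) = Q (b0 x)"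
    and B: "B < d" "\<And>x. x \<in> X \<Longrightarrow> norm (b1 x - b0 x) \<le> B"
    and W: "\<And>x. x \<in> X \<Longrightarrow> ball (b0 x) d \<subseteq> W"
  obtains h h' where "homeomorphism UNIV UNIV h h'" "\<And>x. x \<in> X \<Longrightarrow> h (b0 x) = b1 x"
    "\<And>z. z \<notin> W \<Longrightarrow> h z = z"
proof -
  have B0: "0 \<le> B" using X B(2) norm_ge_zero order_trans by blast
  then have d: "0 < d" using B by simp
  have contQ: "continuous_on S Q" for S
    using Q by (simp add: linear_conv_bounded_linear linear_continuous_on)
  have contQb: "continuous_on X (\<lambda>x. Q (b0 x))"
    by (rule continuous_on_compose2[OF contQ b0]) auto
  obtain r where r: "homeomorphism X ((\<lambda>x. Q (b0 x)) ` X) (\<lambda>x. Q (b0 x)) r"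
    using homeomorphism_compact[OF X(1) contQb _ inj] by blast
  let ?C = "(\<lambda>x. Q (b0 x)) ` X"
  have "compact ?C" using X contQb compact_continuous_image by blast
  then have clC: "closedin (top_of_set UNIV) ?C"
    by (simp add: compact_imp_closed)
  have rC: "r ` ?C = X" and contr: "continuous_on ?C r"
    using r by (auto simp: homeomorphism_def)
  have "continuous_on ?C (\<lambda>y. b1 (r y) - b0 (r y))"
    by (intro continuous_on_diff continuous_on_compose2[OF b1 contr] continuous_on_compose2[OF b0 contr])
      (use rC in auto)
  moreover have "norm (b1 (r y) - b0 (r y)) \<le> B" if "y \<in> ?C" for y
    using that rC B(2) by blast
  ultimately obtain w where w: "continuous_on UNIV w" "\<And>y. y \<in> ?C \<Longrightarrow> w y = b1 (r y) - b0 (r y)"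
    "\<And>y. norm (w y) \<le> B"
    by (rule Tietze[OF _ clC B0, of "\<lambda>y. b1 (r y) - b0 (r y)"]) auto
  let ?K = "b0 ` X"
  \<comment> \<open>The cutoff \<open>l\<close> is \<open>1/d\<close>-Lipschitz and the displacement \<open>v\<close> depends on \<open>Q z\<close> only, so \<open>g\<close> is a
    contraction on the fibres of \<open>Q\<close>.\<close>
  define l where "l z = max 0 (1 - infdist z ?K / d)" for z
  define v where "v z = w (Q z) - Q (w (Q z))" for z
  have contw: "continuous_on UNIV (\<lambda>z. w (Q z))"
    by (rule continuous_on_compose2[OF w(1) contQ]) auto
  have contv: "continuous_on UNIV v"
    unfolding v_def by (intro continuous_on_diff contw continuous_on_compose2[OF contQ contw]) auto
  have contl: "continuous_on UNIV l"
    unfolding l_def by (intro continuous_intros) (use d in auto)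
  have normv: "norm (v z) \<le> B" for z
    unfolding v_def using normQ w(3) order_trans by blast
  have lipl: "\<bar>l z - l z'\<bar> \<le> norm (z - z') / d" for z z'
  proof -
    have "\<bar>l z - l z'\<bar> \<le> \<bar>infdist z ?K / d - infdist z' ?K / d\<bar>"
      unfolding l_def by (auto simp: max_def)
    also have "\<dots> = \<bar>infdist z ?K - infdist z' ?K\<bar> / d"
      using d by (simp add: diff_divide_distrib[symmetric])
    also have "\<dots> \<le> dist z z' / d"
      using d infdist_triangle[of z ?K z'] infdist_triangle[of z' ?K z]
      by (intro divide_right_mono) (auto simp: dist_commute abs_le_iff)
    finally show ?thesis by (simp add: dist_norm)
  qed
  define g where "g z = l z *\<^sub>R v z" for z
  have "continuous_on UNIV g"
    unfolding g_def by (intro continuous_intros contl contv)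
  moreover have "Q (g z) = 0" for z
    unfolding g_def v_def using Q QQ by (simp add: linear_cmul linear_diff)
  moreover have "B / d < 1" using B d by simp
  moreover have "norm (g z - g z') \<le> B / d * norm (z - z')" if "Q z = Q z'" for z z'
  proof -
    have "v z = v z'" using that by (simp add: v_def)
    then have "norm (g z - g z') = \<bar>l z - l z'\<bar> * norm (v z)"
      unfolding g_def by (metis norm_scaleR scaleR_left_diff_distrib)
    also have "\<dots> \<le> (norm (z - z') / d) * B"
      using lipl normv d by (intro mult_mono) auto
    finally show ?thesis by (simp add: mult.commute)
  qed
  ultimately obtain h' where h': "homeomorphism UNIV UNIV (\<lambda>z. z + g z) h'"
    using shear_homeomorphism[OF Q, of g "B / d"] by blast
  show thesis
  proof
    show "homeomorphism UNIV UNIV (\<lambda>z. z + g z) h'" by fact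
    show "b0 x + g (b0 x) = b1 x" if "x \<in> X" for x
    proof -
      \<comment> \<open>On the image the cutoff equals 1, and the correction in \<open>v\<close>
        changes nothing because \<open>b1 x - b0 x\<close> already lies in the kernel of
        \<open>Q\<close>.\<close>
      have "l (b0 x) = 1" using that by (simp add: l_def)
      moreover have "r (Q (b0 x)) = x" using r that by (auto simp: homeomorphism_def)
      then have "w (Q (b0 x)) = b1 x - b0 x" using w(2) that by auto
      ultimately show ?thesis
        using Q Qeq[OF that] by (simp add: g_def v_def linear_diff)
    qed
    show "z + g z = z" if "z \<notin> W" for z
    proof -
      have "d \<le> infdist z ?K"
      proof -
        have "d \<le> dist z y" if "y \<in> ?K" for y
        proof -
          obtain x where "x \<in> X" "y = b0 x" using \<open>y \<in> ?K\<close> by blast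
          then have "z \<notin> ball y d" using W \<open>z \<notin> W\<close> by blast
          then show ?thesis by (simp add: dist_commute)
        qed
        then show ?thesis
          using X by (auto simp: infdist_def intro!: cINF_greatest)
      qed
      then show ?thesis using d by (simp add: g_def l_def)
    qed
  qed
qed

text \<open>Uniform continuity cuts the isotopy into steps of length at most \<open>d / 2\<close>,
  where \<open>d\<close> is a margin between its compact track and the complement of
  \<open>W\<close>. Each step is a push, and the pushes are composed. The \<open>Q\<close>-part is
  constant in time, so it identifies \<open>x\<close> at every stage.\<close>

lemma isotopy_homeomorphism:
  fixes G :: "real \<Rightarrow> 'a::metric_space \<Rightarrow> 'b::euclidean_space"
  assumes X: "compact X" "X \<noteq> {}" and G: "continuous_on ({0..1} \<times> X) (\<lambda>(t, x). G t x)"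
    and Q: "linear Q" and QQ: "\<And>z. Q (Q z) = Q z" and normQ: "\<And>z. norm (z - Q z) \<le> norm z"
    and inj: "inj_on (\<lambda>x. Q (G 0 x)) X"
    and Qeq: "\<And>x t. x \<in> X \<Longrightarrow> 0 \<le> t \<Longrightarrow> t \<le> 1 \<Longrightarrow> Q (G t x) = Q (G 0 x)"
    and W: "open W" "\<And>x t. x \<in> X \<Longrightarrow> 0 \<le> t \<Longrightarrow> t \<le> 1 \<Longrightarrow> G t x \<in> W"
  obtains h h' where "homeomorphism UNIV UNIV h h'" "\<And>x. x \<in> X \<Longrightarrow> h (G 0 x) = G 1 x"
    "\<And>z. z \<notin> W \<Longrightarrow> h z = z"
proof -
  have cI: "compact ({0..1::real} \<times> X)" by (intro compact_Times X compact_Icc)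
  let ?K = "(\<lambda>(t, x). G t x) ` ({0..1} \<times> X)"
  have "compact ?K" by (rule compact_continuous_image[OF G cI])
  moreover have "?K \<subseteq> W" using W(2) by auto
  ultimately obtain d where d: "0 < d" "(\<Union>y\<in>?K. ball y d) \<subseteq> W"
    using compact_subset_open_imp_ball_epsilon_subset[OF _ W(1), of ?K] by blast
  have "uniformly_continuous_on ({0..1} \<times> X) (\<lambda>(t, x). G t x)"
    by (rule compact_uniformly_continuous[OF G cI])
  then obtain \<eta> where \<eta>: "0 < \<eta>" "\<And>p p'. p \<in> {0..1} \<times> X \<Longrightarrow> p' \<in> {0..1} \<times> X \<Longrightarrow> dist p' p < \<eta> \<Longrightarrow>
      dist ((\<lambda>(t, x). G t x) p') ((\<lambda>(t, x). G t x) p) < d / 2"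
    unfolding uniformly_continuous_on_def using d(1) by (meson half_gt_zero)
  obtain n :: nat where n: "n > 0" "1 / real n < \<eta>"
    using \<eta>(1) by (metis nat_approx_posE of_nat_0_less_iff zero_less_Suc)
  have contG: "continuous_on X (G t)" if "0 \<le> t" "t \<le> 1" for t
  proof -
    have "continuous_on X (\<lambda>x. (\<lambda>(t, x). G t x) (t, x))"
      by (rule continuous_on_compose2[OF G]) (use that in \<open>auto intro!: continuous_intros\<close>)
    then show ?thesis by simp
  qed
  have "i \<le> n \<Longrightarrow> \<exists>h h'. homeomorphism UNIV UNIV h h' \<and> (\<forall>x\<in>X. h (G 0 x) = G (real i / real n) x) \<and>
      (\<forall>z. z \<notin> W \<longrightarrow> h z = z)" for i
  proof (induction i)
    case 0
    show ?case
      by (rule exI[of _ id], rule exI[of _ id]) (auto simp: homeomorphism_def)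
  next
    case (Suc i)
    then obtain h h' where h: "homeomorphism UNIV UNIV h h'"
      "\<And>x. x \<in> X \<Longrightarrow> h (G 0 x) = G (real i / real n) x" "\<And>z. z \<notin> W \<Longrightarrow> h z = z"
      by (metis Suc_leD)
    let ?t = "real i / real n" and ?t' = "real (Suc i) / real n"
    have t: "0 \<le> ?t" "?t \<le> 1" "0 \<le> ?t'" "?t' \<le> 1"
      using Suc.prems n by (auto simp: divide_simps)
    have tt: "\<bar>?t' - ?t\<bar> < \<eta>" using n by (simp add: diff_divide_distrib[symmetric])
    obtain k k' where k: "homeomorphism UNIV UNIV k k'" "\<And>x. x \<in> X \<Longrightarrow> k (G ?t x) = G ?t' x"
      "\<And>z. z \<notin> W \<Longrightarrow> k z = z"
    proof (rule push_homeomorphism[OF X contG[OF t(1,2)] contG[OF t(3,4)] Q QQ normQ, of "d / 2" d W])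
      show "inj_on (\<lambda>x. Q (G ?t x)) X"
        using inj Qeq t unfolding inj_on_def by metis
      show "Q (G ?t' x) = Q (G ?t x)" if "x \<in> X" for x
        using that Qeq t by metis
      show "d / 2 < d" using d by simp
      show "norm (G ?t' x - G ?t x) \<le> d / 2" if "x \<in> X" for x
        using \<eta>(2)[of "(?t, x)" "(?t', x)"] that t tt
        by (simp add: dist_norm dist_Pair_Pair less_imp_le)
      show "ball (G ?t x) d \<subseteq> W" if "x \<in> X" for x
        using d(2) that t by (auto simp: UN_subset_iff)
    qed blast
    have "homeomorphism UNIV UNIV (k \<circ> h) (h' \<circ> k')"
      by (rule homeomorphism_compose[OF h(1) k(1)])
    moreover have "\<forall>x\<in>X. (k \<circ> h) (G 0 x) = G ?t' x" using h k by simp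
    moreover have "\<forall>z. z \<notin> W \<longrightarrow> (k \<circ> h) z = z" using h k by simp
    ultimately show ?case by blast
  qed
  from this[of n] n show ?thesis using that by auto
qed

text \<open>The vector from the nearest point of the ball to \<open>z\<close> is scaled by
  \<open>\<kappa>\<close>. Points of the ball are their own nearest points and stay fixed; elsewhere
  the image is a convex combination of \<open>z\<close> and a point of the ball, which gives the
  distance bound.\<close>

lemma contraction_towards_ball:
  fixes q :: "'b::euclidean_space"
  assumes "0 < \<kappa>" "\<kappa> \<le> 1" "0 \<le> \<delta>"
  obtains h h' where "homeomorphism UNIV UNIV h h'" "\<And>z. z \<in> cball q \<delta> \<Longrightarrow> h z = z"
    "\<And>z. dist q (h z) \<le> \<kappa> * dist q z + \<delta>"
proof -
  let ?C = "cball q \<delta>"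
  define p where "p = closest_point ?C"
  have C: "closed ?C" "convex ?C" "?C \<noteq> {}" using assms by auto
  have pC: "p z \<in> ?C" for z unfolding p_def using C by (rule_tac closest_point_in_set)
  have contp: "continuous_on UNIV p" unfolding p_def using C by (intro continuous_on_closest_point)
  have ray: "p (p z + s *\<^sub>R (z - p z)) = p z" if "0 \<le> s" for s z
  proof -
    \<comment> \<open>The obtuse-angle inequality at the nearest point survives scaling of the
      normal vector by \<open>s \<ge> 0\<close>, so the same point is nearest along the whole
      ray.\<close>
    have "\<forall>c\<in>?C. dist (p z + s *\<^sub>R (z - p z)) (p z) \<le> dist (p z + s *\<^sub>R (z - p z)) c"
    proof
      fix c assume "c \<in> ?C"
      then have "inner (z - p z) (c - p z) \<le> 0"
        unfolding p_def using C by (intro closest_point_dot)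
      then have "inner (s *\<^sub>R (z - p z)) (c - p z) \<le> 0"
        using that by (simp add: mult_nonneg_nonpos)
      then have "0 \<le> (norm (c - p z))\<^sup>2 - 2 * inner (s *\<^sub>R (z - p z)) (c - p z)"
        using zero_le_power2[of "norm (c - p z)"] by linarith
      then have "(norm (s *\<^sub>R (z - p z)))\<^sup>2 \<le> (norm (s *\<^sub>R (z - p z) - (c - p z)))\<^sup>2"
        unfolding dot_norm_neg by simp
      then have "norm (s *\<^sub>R (z - p z)) \<le> norm (s *\<^sub>R (z - p z) - (c - p z))"
        using norm_ge_zero power2_le_imp_le by blast
      then show "dist (p z + s *\<^sub>R (z - p z)) (p z) \<le> dist (p z + s *\<^sub>R (z - p z)) c"
        by (simp add: dist_norm algebra_simps)
    qed
    then show ?thesis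
      unfolding p_def[symmetric] using closest_point_unique[OF C(2,1) pC] p_def by metis
  qed
  \<comment> \<open>\<open>ray\<close> says that moving along the ray from \<open>p z\<close> through \<open>z\<close> does not change the nearest point,
    which makes the following two maps mutually inverse.\<close>
  define h where "h z = p z + \<kappa> *\<^sub>R (z - p z)" for z
  define h' where "h' z = p z + (1 / \<kappa>) *\<^sub>R (z - p z)" for z
  have "homeomorphism UNIV UNIV h h'"
  proof (rule homeomorphismI)
    show "continuous_on UNIV h" "continuous_on UNIV h'"
      unfolding h_def h'_def by (intro continuous_intros contp)+
    show "h' (h z) = z" for z
      using ray[of \<kappa> z] assms by (simp add: h_def h'_def)
    show "h (h' z) = z" for z
      using ray[of "1 / \<kappa>" z] assms by (simp add: h_def h'_def)
  qed auto
  moreover have "h z = z" if "z \<in> ?C" for z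
    using closest_point_self[OF that] by (simp add: h_def p_def)
  moreover have "dist q (h z) \<le> \<kappa> * dist q z + \<delta>" for z
  proof -
    have "h z - q = (1 - \<kappa>) *\<^sub>R (p z - q) + \<kappa> *\<^sub>R (z - q)"
      by (simp add: h_def algebra_simps)
    then have "norm (h z - q) \<le> (1 - \<kappa>) * norm (p z - q) + \<kappa> * norm (z - q)"
      using assms norm_triangle_ineq[of "(1 - \<kappa>) *\<^sub>R (p z - q)" "\<kappa> *\<^sub>R (z - q)"] by simp
    also have "(1 - \<kappa>) * norm (p z - q) \<le> 1 * \<delta>"
      using assms pC[of z] by (intro mult_mono) (auto simp: dist_norm norm_minus_commute)
    finally show ?thesis by (simp add: dist_norm norm_minus_commute)
  qed
  ultimately show ?thesis by (rule that)
qed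

text \<open>A bijection fixing the complement of \<open>W\<close> pointwise maps \<open>W\<close> to
  itself, so any bound for the norms on \<open>W\<close> serves as \<open>C\<close>.\<close>

lemma bounded_displacement:
  fixes h :: "'c::real_normed_vector \<Rightarrow> 'c"
  assumes h: "homeomorphism UNIV UNIV h h'" and W: "bounded W" "\<And>z. z \<notin> W \<Longrightarrow> h z = z"
  obtains C where "\<And>z. norm (h z) \<le> norm z + C" "\<And>z. z \<in> W \<Longrightarrow> h z \<in> W" "\<And>z. z \<in> W \<Longrightarrow> h' z \<in> W"
    "\<And>z. norm (h' z) \<le> norm z + C"
proof -
  have hh: "h' (h z) = z" "h (h' z) = z" for z using h by (auto simp: homeomorphism_def)
  obtain C where C: "0 < C" "\<And>z. z \<in> W \<Longrightarrow> norm z \<le> C" using W(1) unfolding bounded_pos by blast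
  have hW: "h z \<in> W" if "z \<in> W" for z
  proof (rule ccontr)
    assume n: "h z \<notin> W"
    then have "h (h z) = h z" by (rule W(2))
    then have "h' (h (h z)) = h' (h z)" by simp
    then have "h z = z" by (simp only: hh)
    then show False using n that by simp
  qed
  have h'out: "h' z = z" if "z \<notin> W" for z using hh(1)[of z] W(2)[OF that] by simp
  have h'W: "h' z \<in> W" if "z \<in> W" for z
  proof (rule ccontr)
    assume n: "h' z \<notin> W"
    then have "h (h' z) = h' z" by (rule W(2))
    then show False using n that by (simp add: hh)
  qed
  have "norm (h z) \<le> norm z + C" for z
  proof (cases "z \<in> W")
    case True then show ?thesis using C(2)[OF hW[OF True]] norm_ge_zero[of z] by linarith
  next
    case False then show ?thesis using W(2) C(1) by simp
  qed
  moreover have "norm (h' z) \<le> norm z + C" for z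
  proof (cases "z \<in> W")
    case True then show ?thesis using C(2)[OF h'W[OF True]] norm_ge_zero[of z] by linarith
  next
    case False then show ?thesis using h'out C(1) by simp
  qed
  ultimately show ?thesis using hW h'W by (intro that)
qed

subsection \<open>Attractors\<close>

lemma semidist_le:
  assumes "\<And>a. a \<in> A \<Longrightarrow> \<exists>b\<in>B. norm (a - b) \<le> r"
  shows "semidist A B \<le> ennreal r"
  unfolding semidist_def
proof (rule SUP_least)
  fix a assume "a \<in> A"
  then obtain b where "b \<in> B" "norm (a - b) \<le> r" using assms by blast
  then show "(INF b\<in>B. ennreal (norm (a - b))) \<le> ennreal r"
    by (meson INF_lower2 ennreal_leI)
qed

text \<open>The attractor is the intersection of the forward images of the ball. The last conclusion
  is what localises it: controlling a single image of the ball is enough.\<close>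

lemma absorbing_ball_attractor:
  fixes f :: "'b::euclidean_space \<Rightarrow> 'b"
  assumes f: "homeomorphism UNIV UNIV f f'" and R: "0 < R"
    and out: "\<And>z. R < norm z \<Longrightarrow> norm (f z) \<le> norm z / 2"
    and ball: "f ` cball 0 R \<subseteq> cball 0 R" and A: "f ` A = A" "A \<subseteq> cball 0 R"
  obtains Af where "global_attractor f Af" "A \<subseteq> Af" "Af \<subseteq> f ` cball 0 R"
proof -
  let ?D = "cball 0 R :: 'b set"
  have contf: "continuous_on S f" for S
    using f by (meson continuous_on_subset homeomorphism_def subset_UNIV)
  have injf: "inj f" using f by (metis UNIV_I homeomorphism_apply1 injI)
  define D where "D n = (f ^^ n) ` ?D" for n
  have DSuc: "D (Suc n) = f ` D n" for n by (auto simp: D_def image_comp)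
  have step: "D (Suc n) \<subseteq> D n" for n
  proof (induction n)
    case 0 then show ?case using ball by (simp add: D_def)
  next
    case (Suc n) then show ?case by (metis DSuc image_mono)
  qed
  then have anti: "D n \<subseteq> D m" if "m \<le> n" for m n
    using lift_Suc_antimono_le[of D] step that by blast
  have cD: "compact (D n)" for n
  proof (induction n)
    case 0 then show ?case by (simp add: D_def)
  next
    case (Suc n) then show ?case by (metis DSuc compact_continuous_image contf)
  qed
  define Af where "Af = (\<Inter>n. D n)"
  have AD: "A \<subseteq> D n" for n
  proof (induction n)
    case 0 then show ?case using A by (simp add: D_def)
  next
    case (Suc n) then show ?case by (metis DSuc image_mono A(1))
  qed
  have cAf: "compact Af" unfolding Af_def
    by (rule compact_Inter) (use cD in auto)
  \<comment> \<open>Injectivity lets the image commute with the intersection, and a decreasing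
    sequence may lose its first member without changing its intersection.\<close>
  have invar: "f ` Af = Af"
  proof -
    have "f ` Af = (\<Inter>n. D (Suc n))"
      unfolding Af_def DSuc using injf by (subst image_INT) auto
    also have "\<dots> = Af"
      unfolding Af_def using step by blast
    finally show ?thesis .
  qed
  have absorb: "\<exists>N. \<forall>n\<ge>N. (f ^^ n) ` B \<subseteq> ?D" if B: "bounded B" for B
  proof -
    have stay: "(f ^^ n) z \<in> ?D \<Longrightarrow> (f ^^ (n + m)) z \<in> ?D" for n m z
      by (induction m) (use ball[unfolded image_subset_iff] in auto)
    obtain M where M: "\<And>z. z \<in> B \<Longrightarrow> norm z \<le> M" "M > 0" using B bounded_pos by blast
    \<comment> \<open>The norm halves at each step until the orbit enters the ball, where it then
      stays.\<close>
    have red: "(f ^^ n) z \<in> ?D \<or> norm ((f ^^ n) z) \<le> M / 2 ^ n" if "z \<in> B" for z n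
    proof (induction n)
      case 0 then show ?case using M that by simp
    next
      case (Suc n)
      show ?case
      proof (cases "(f ^^ n) z \<in> ?D")
        case True then show ?thesis using stay[of n z 1] by simp
      next
        case False
        then have "norm (f ((f ^^ n) z)) \<le> norm ((f ^^ n) z) / 2" using out by simp
        then show ?thesis using False Suc by simp
      qed
    qed
    obtain N where "M / R < 2 ^ N" using real_arch_pow[of 2 "M / R"] by auto
    then have N: "M / 2 ^ N \<le> R" using R by (simp add: field_simps)
    have "(f ^^ n) ` B \<subseteq> ?D" if "n \<ge> N" for n
    proof
      fix y assume "y \<in> (f ^^ n) ` B"
      then obtain z where z: "z \<in> B" "y = (f ^^ n) z" by blast
      have "(f ^^ N) z \<in> ?D" using red[OF z(1), of N] N by auto
      then have "(f ^^ (N + (n - N))) z \<in> ?D" by (rule stay)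
      then show "y \<in> ?D" using that z by simp
    qed
    then show ?thesis by blast
  qed
  \<comment> \<open>Otherwise the sets \<open>D n - U\<close> would be nested, compact and nonempty,
    hence have a common point.\<close>
  have near: "\<exists>N. D N \<subseteq> U" if U: "open U" "Af \<subseteq> U" for U
  proof (rule ccontr)
    assume "\<not> (\<exists>N. D N \<subseteq> U)"
    then have ne: "D n - U \<noteq> {}" for n by blast
    have "(\<Inter>n. D n - U) \<noteq> {}"
    proof (rule compact_nest)
      show "compact (D n - U)" for n using cD U by (intro compact_diff)
      show "D n - U \<noteq> {}" for n by (rule ne)
      show "m \<le> n \<Longrightarrow> D n - U \<subseteq> D m - U" for m n using anti by blast
    qed
    then show False using U by (auto simp: Af_def)
  qed
  have "(\<lambda>n. semidist ((f ^^ n) ` B) Af) \<longlonglongrightarrow> 0" if B: "bounded B" for B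
  proof (rule order_tendstoI)
    fix a :: ennreal assume "a < 0" then show "\<forall>\<^sub>F n in sequentially. a < semidist ((f ^^ n) ` B) Af"
      by simp
  next
    fix a :: ennreal assume "0 < a"
    then obtain c where c: "0 < c" "c < a" using dense by blast
    obtain r where r: "0 < r" "ennreal r < a"
    proof (cases c)
      case (real r)
      then show ?thesis using c that[of r] by auto
    next
      case top
      then show ?thesis using c by simp
    qed
    obtain N where N: "D N \<subseteq> (\<Union>x\<in>Af. ball x r)"
    proof -
      have "Af \<subseteq> (\<Union>x\<in>Af. ball x r)" using r by auto
      then show ?thesis using near[of "\<Union>x\<in>Af. ball x r"] that by blast
    qed
    obtain M where M: "\<And>n. n \<ge> M \<Longrightarrow> (f ^^ n) ` B \<subseteq> ?D" using absorb[OF B] by blast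
    have "semidist ((f ^^ n) ` B) Af < a" if "n \<ge> N + M" for n
    proof -
      \<comment> \<open>The first \<open>n - N\<close> iterates bring \<open>B\<close> into the
        ball, the remaining \<open>N\<close> carry the ball to \<open>D N\<close>.\<close>
      have "(f ^^ n) ` B = (f ^^ N) ` (f ^^ (n - N)) ` B"
        using that by (simp add: image_comp flip: funpow_add)
      also have "\<dots> \<subseteq> D N" unfolding D_def using M that by (intro image_mono) auto
      finally have sub: "(f ^^ n) ` B \<subseteq> (\<Union>x\<in>Af. ball x r)" using N by blast
      have "semidist ((f ^^ n) ` B) Af \<le> ennreal r"
      proof (rule semidist_le)
        fix y assume "y \<in> (f ^^ n) ` B"
        then obtain b where "b \<in> Af" "y \<in> ball b r" using sub by blast
        then show "\<exists>b\<in>Af. norm (y - b) \<le> r"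
          by (intro bexI[of _ b]) (auto simp: dist_norm norm_minus_commute)
      qed
      then show ?thesis using r(2) by simp
    qed
    then show "\<forall>\<^sub>F n in sequentially. semidist ((f ^^ n) ` B) Af < a"
      unfolding eventually_sequentially by blast
  qed
  then have "global_attractor f Af"
    unfolding global_attractor_def using contf cAf invar by blast
  moreover have "A \<subseteq> Af" unfolding Af_def using AD by blast
  moreover have "Af \<subseteq> f ` ?D"
  proof -
    have "D (Suc 0) = f ` ?D" using DSuc[of 0] by (simp add: D_def)
    then show ?thesis unfolding Af_def by blast
  qed
  ultimately show thesis by (rule that)
qed

section \<open>Covering dimension and extension of maps from compact sets\<close>

text \<open>A witness can be extracted from an infimum only through a strict inequality, so the
  bound is relaxed to \<open>k + 1\<close>. Integrality recovers \<open>m \<le> Suc k\<close>, and a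
  bound on the order may always be weakened.\<close>

lemma covering_dim_le_refinements:
  assumes "covering_dim X \<le> ereal (real k)"
  shows "refinements_of_order_le X (Suc k)"
proof -
  have "covering_dim X < ereal (real k + 1)"
    using assms by (rule order_le_less_trans) simp
  then have "\<exists>m\<in>{m. refinements_of_order_le X m}. ereal (real m - 1) < ereal (real k + 1)"
    unfolding covering_dim_def INF_less_iff .
  then obtain m where m: "refinements_of_order_le X m" "ereal (real m - 1) < ereal (real k + 1)"
    by blast
  from m(2) have "real m - 1 < real k + 1" by (rule less_ereal.simps(1)[THEN iffD1])
  then have "m \<le> Suc k" by simp
  show ?thesis
    unfolding refinements_of_order_le_def
  proof (intro allI impI)
    fix \<U> assume "finite \<U> \<and> (\<forall>U\<in>\<U>. openin X U) \<and> \<Union>\<U> = topspace X"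
    then have "\<exists>\<V>. finite \<V> \<and> (\<forall>V\<in>\<V>. openin X V) \<and> \<Union>\<V> = topspace X \<and>
        (\<forall>V\<in>\<V>. \<exists>U\<in>\<U>. V \<subseteq> U) \<and> (\<forall>x\<in>topspace X. card {V \<in> \<V>. x \<in> V} \<le> m)"
      using m(1)[unfolded refinements_of_order_le_def, THEN spec, of \<U>] by (rule rev_mp)
    then obtain \<V> where \<V>: "finite \<V>" "\<forall>V\<in>\<V>. openin X V" "\<Union>\<V> = topspace X"
        "\<forall>V\<in>\<V>. \<exists>U\<in>\<U>. V \<subseteq> U" "\<forall>x\<in>topspace X. card {V \<in> \<V>. x \<in> V} \<le> m"
      by (elim exE conjE)
    have "\<forall>x\<in>topspace X. card {V \<in> \<V>. x \<in> V} \<le> Suc k"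
      using \<V>(5) \<open>m \<le> Suc k\<close> by (auto intro: order_trans)
    with \<V>(1-4) show "\<exists>\<V>. finite \<V> \<and> (\<forall>V\<in>\<V>. openin X V) \<and> \<Union>\<V> = topspace X \<and>
        (\<forall>V\<in>\<V>. \<exists>U\<in>\<U>. V \<subseteq> U) \<and> (\<forall>x\<in>topspace X. card {V \<in> \<V>. x \<in> V} \<le> Suc k)"
      by (intro exI[of _ \<V>] conjI)
  qed
qed

text \<open>The domain may be an infinite-dimensional normed space. The extension is made coordinate
  by coordinate and rests only on normality of metric spaces; it serves to extend the embedding of
  the attractor to all of \<open>E\<close>.\<close>

lemma Tietze_compact:
  fixes f :: "'a::metric_space \<Rightarrow> 'b::euclidean_space"
  assumes "compact X" "continuous_on X f"
  obtains g where "continuous_on UNIV g" "\<And>x. x \<in> X \<Longrightarrow> g x = f x"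
proof -
  have "\<forall>b. \<exists>g. continuous_on UNIV g \<and> (\<forall>x\<in>X. g x = f x \<bullet> b)"
  proof
    fix b
    have n: "normal_space (euclidean :: 'a topology)"
      by (rule metrizable_imp_normal_space[OF metrizable_space_euclidean])
    have "continuous_on X (\<lambda>x. f x \<bullet> b)" by (intro continuous_intros assms)
    then have c: "continuous_map (subtopology euclidean X) euclideanreal (\<lambda>x. f x \<bullet> b)" by simp
    have "closedin euclidean X" using assms compact_imp_closed by auto
    then obtain g where "continuous_map euclidean euclideanreal g" "\<And>x. x \<in> X \<Longrightarrow> g x = f x \<bullet> b"
      using Tietze_extension_realinterval[OF n _ is_interval_univ UNIV_not_empty c] by auto
    then show "\<exists>g. continuous_on UNIV g \<and> (\<forall>x\<in>X. g x = f x \<bullet> b)" by auto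
  qed
  from choice[OF this] obtain g where "\<forall>b. continuous_on UNIV (g b) \<and> (\<forall>x\<in>X. g b x = f x \<bullet> b)"
    by (elim exE)
  then have g: "continuous_on UNIV (g b)" "x \<in> X \<Longrightarrow> g b x = f x \<bullet> b" for b x by blast+
  show ?thesis
  proof
    show "continuous_on UNIV (\<lambda>x. \<Sum>b\<in>Basis. g b x *\<^sub>R b)" by (intro continuous_intros g)
    show "(\<Sum>b\<in>Basis. g b x *\<^sub>R b) = f x" if "x \<in> X" for x
      using g(2)[OF that] by (simp add: euclidean_representation)
  qed
qed

section \<open>Absorption and contractibility near a global attractor\<close>

text \<open>An infimum over the empty set is infinite, so the orbit of a single point would keep
  infinite semidistance from an empty attractor.\<close>

lemma global_attractor_nonempty:
  assumes "global_attractor F \<A>"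
  shows "\<A> \<noteq> {}"
proof
  assume "\<A> = {}"
  then have "(\<lambda>n. semidist ((F ^^ n) ` {0}) \<A>) = (\<lambda>n. top)"
    by (intro ext) (simp add: semidist_def)
  moreover have "(\<lambda>n. semidist ((F ^^ n) ` {0}) \<A>) \<longlonglongrightarrow> 0"
    using assms bounded_insert bounded_empty unfolding global_attractor_def by blast
  ultimately have "(\<lambda>n::nat. top :: ennreal) \<longlonglongrightarrow> 0" by (simp only:)
  then have "top = (0 :: ennreal)" using LIMSEQ_unique tendsto_const by blast
  then show False by simp
qed

text \<open>By compactness a tube of some radius \<open>d\<close> around the attractor lies in
  \<open>U\<close>, and a semidistance below \<open>d\<close> puts the image inside this
  tube.\<close>

lemma global_attractor_absorbed:
  assumes F: "global_attractor F \<A>" and B: "bounded B" and U: "open U" "\<A> \<subseteq> U"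
  obtains n where "(F ^^ n) ` B \<subseteq> U"
proof -
  obtain d where d: "0 < d" "(\<Union>x\<in>\<A>. ball x d) \<subseteq> U"
    using compact_subset_open_imp_ball_epsilon_subset[of \<A> U] F U unfolding global_attractor_def by blast
  have "(\<lambda>n. semidist ((F ^^ n) ` B) \<A>) \<longlonglongrightarrow> 0"
    using F B unfolding global_attractor_def by blast
  then have "\<forall>\<^sub>F n in sequentially. semidist ((F ^^ n) ` B) \<A> < ennreal d"
    by (rule order_tendstoD) (use d in simp)
  then obtain n where n: "semidist ((F ^^ n) ` B) \<A> < ennreal d"
    by (auto simp: eventually_sequentially)
  have "(F ^^ n) ` B \<subseteq> U"
  proof
    fix y assume y: "y \<in> (F ^^ n) ` B"
    have "(INF a\<in>\<A>. ennreal (norm (y - a))) \<le> semidist ((F ^^ n) ` B) \<A>"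
      unfolding semidist_def by (rule SUP_upper[OF y])
    then have "(INF a\<in>\<A>. ennreal (norm (y - a))) < ennreal d"
      using n by (rule order_le_less_trans)
    then obtain a where "a \<in> \<A>" "norm (y - a) < d"
      unfolding INF_less_iff by (auto simp: ennreal_less_iff)
    then have "y \<in> (\<Union>x\<in>\<A>. ball x d)" by (auto simp: dist_norm norm_minus_commute)
    then show "y \<in> U" using d by blast
  qed
  then show ?thesis by (rule that)
qed

text \<open>A straight-line homotopy of the attractor runs in its convex hull, which is bounded, so
  some \<open>F ^^ n\<close> carries the whole track into \<open>U\<close>. Applying
  \<open>F' ^^ n\<close> beforehand, which preserves the attractor, restores the required
  endpoints.\<close>

lemma global_attractor_contractible_nearby:
  assumes FF: "homeomorphism UNIV UNIV F F'" and F: "global_attractor F \<A>"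
    and U: "open U" "\<A> \<subseteq> U" and p: "p \<in> \<A>"
  obtains H where "continuous_on ({0..1} \<times> \<A>) (\<lambda>(t, x). H t x)"
    "\<And>x. H 0 x = x" "\<And>x. H 1 x = p"
    "\<And>t x. 0 \<le> t \<Longrightarrow> t \<le> (1::real) \<Longrightarrow> x \<in> \<A> \<Longrightarrow> H t x \<in> U"
proof -
  have "compact \<A>" and FA: "F ` \<A> = \<A>" using F unfolding global_attractor_def by blast+
  then have "bounded (convex hull \<A>)" by (intro bounded_convex_hull compact_imp_bounded)
  then obtain n where n: "(F ^^ n) ` (convex hull \<A>) \<subseteq> U"
    by (rule global_attractor_absorbed[OF F _ U])
  have F'F: "F' (F x) = x" "F (F' x) = x" for x
    using FF by (auto simp: homeomorphism_def)
  have pow: "(F ^^ m) ((F' ^^ m) x) = x" for m x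
  proof (induction m)
    case (Suc m)
    have "(F ^^ Suc m) ((F' ^^ Suc m) x) = (F ^^ m) (F (F' ((F' ^^ m) x)))"
      by (simp only: funpow_Suc_right[of m F] funpow.simps(2)[of m F'] o_apply)
    then show ?case unfolding F'F(2) Suc .
  qed simp
  have "F' x \<in> \<A>" if "x \<in> \<A>" for x
  proof -
    have "x \<in> F ` \<A>" using that FA by simp
    then obtain y where "y \<in> \<A>" "x = F y" by blast
    then show ?thesis by (simp only: F'F(1))
  qed
  then have pow_in: "(F' ^^ m) x \<in> \<A>" if "x \<in> \<A>" for m x
    using that by (induction m) simp_all
  have "continuous_on UNIV F" "continuous_on UNIV F'" by (rule homeomorphism_cont1[OF FF], rule homeomorphism_cont2[OF FF])
  have contpow: "continuous_on UNIV (f ^^ m)" if "continuous_on UNIV f" for f :: "'a \<Rightarrow> 'a" and m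
  proof (induction m)
    case (Suc m)
    show ?case using continuous_on_compose2[OF that Suc] by (simp add: o_def)
  qed (simp add: id_def)
  note cont = contpow[OF \<open>continuous_on UNIV F\<close>] contpow[OF \<open>continuous_on UNIV F'\<close>]
  define H where "H t x = (F ^^ n) ((1 - t) *\<^sub>R (F' ^^ n) x + t *\<^sub>R (F' ^^ n) p)" for t x
  show ?thesis
  proof
    show "continuous_on ({0..1} \<times> \<A>) (\<lambda>(t, x). H t x)"
    proof -
      have "continuous_on ({0..1::real} \<times> \<A>) (\<lambda>z. (F' ^^ n) (snd z))"
        by (rule continuous_on_compose2[OF cont(2)]) (auto intro: continuous_intros)
      then have "continuous_on ({0..1} \<times> \<A>) (\<lambda>z. (1 - fst z) *\<^sub>R (F' ^^ n) (snd z) + fst z *\<^sub>R (F' ^^ n) p)"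
        by (intro continuous_intros)
      then show ?thesis
        unfolding H_def case_prod_unfold by (rule continuous_on_compose2[OF cont(1)]) auto
    qed
    show "H 0 x = x" "H 1 x = p" for x by (simp_all add: H_def pow)
    show "H t x \<in> U" if "0 \<le> t" "t \<le> 1" "x \<in> \<A>" for t x
    proof -
      have "(F' ^^ n) x \<in> convex hull \<A>" "(F' ^^ n) p \<in> convex hull \<A>"
        using pow_in p that by (auto intro: hull_inc)
      then have "(1 - t) *\<^sub>R (F' ^^ n) x + t *\<^sub>R (F' ^^ n) p \<in> convex hull \<A>"
        using that by (intro convexD[OF convex_convex_hull]) auto
      then show ?thesis unfolding H_def using n by blast
    qed
  qed
qed

subsection \<open>The Menger--Noebeling embedding theorem\<close>

text \<open>Subspaces are closed, so a point off the earlier ones can be moved slightly without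
  meeting them again; a move in a direction outside the new subspace \<open>T\<close> leaves
  \<open>T\<close>.\<close>

lemma subspace_avoid_finite_union:
  fixes S :: "'b::euclidean_space set"
  assumes "finite \<T>" "\<And>T. T \<in> \<T> \<Longrightarrow> subspace T" "\<And>T. T \<in> \<T> \<Longrightarrow> \<not> S \<subseteq> T"
    and S: "subspace S" "p \<in> S" and \<eta>: "0 < \<eta>"
  shows "\<exists>v\<in>S. dist v p < \<eta> \<and> v \<notin> \<Union>\<T>"
  using assms(1-3)
proof (induction \<T> rule: finite_induct)
  case empty
  then show ?case using S \<eta> by (intro bexI[of _ p]) auto
next
  case (insert T \<T>)
  then obtain v where v: "v \<in> S" "dist v p < \<eta>" "v \<notin> \<Union>\<T>" by auto
  have T: "subspace T" using insert.prems by blast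
  obtain w where w: "w \<in> S" "w \<notin> T" using insert.prems by blast
  show ?case
  proof (cases "v \<in> T")
    case False
    then show ?thesis using v by auto
  next
    case True
    have "closed (\<Union>\<T>)"
      using insert.prems insert.hyps by (intro closed_Union) (auto intro: closed_subspace)
    then obtain r where r: "0 < r" "ball v r \<subseteq> - \<Union>\<T>"
      using v(3) by (metis ComplI open_Compl open_contains_ball)
    \<comment> \<open>The \<open>+ 1\<close> avoids a division by zero and makes
      \<open>t * norm w\<close> strictly smaller than both tolerances.\<close>
    define t where "t = min r (\<eta> - dist v p) / (norm w + 1)"
    have t: "0 < t" using r v by (simp add: t_def add_nonneg_pos)
    have "t * norm w < t * (norm w + 1)" using t by simp
    also have "\<dots> = min r (\<eta> - dist v p)" by (simp add: t_def add_nonneg_eq_0_iff)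
    finally have tw: "t * norm w < r" "t * norm w < \<eta> - dist v p" by auto
    let ?u = "v + t *\<^sub>R w"
    have "?u \<in> S" using S v w by (simp add: subspace_add subspace_scale)
    moreover have "dist ?u p < \<eta>"
      using dist_triangle[of ?u p v] tw t by (simp add: dist_norm)
    moreover have "?u \<notin> \<Union>\<T>" using r tw t by (auto simp: subset_iff dist_norm)
    moreover have "?u \<notin> T"
    proof
      assume "?u \<in> T"
      then have "(1 / t) *\<^sub>R (?u - v) \<in> T"
        using True T by (intro subspace_scale subspace_diff)
      then show False using w t by simp
    qed
    ultimately show ?thesis by blast
  qed
qed

text \<open>The vectors are chosen one at a time, each off the spans of fewer than \<open>m\<close>
  earlier ones; these are finitely many and cannot contain \<open>S\<close>, since
  \<open>m \<le> dim S\<close>. Linear rather than affine independence is obtained, which costs one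
  dimension against the classical \<open>2k+1\<close> of the embedding theorem.\<close>

lemma general_position:
  fixes S :: "'b::euclidean_space set"
  assumes "finite I" "\<And>i. i \<in> I \<Longrightarrow> p i \<in> S"
    and S: "subspace S" "m \<le> dim S" and \<eta>: "0 < \<eta>"
  shows "\<exists>v. (\<forall>i\<in>I. v i \<in> S \<and> dist (v i) (p i) < \<eta>) \<and>
    (\<forall>J c. J \<subseteq> I \<longrightarrow> card J \<le> m \<longrightarrow> (\<Sum>j\<in>J. c j *\<^sub>R v j) = 0 \<longrightarrow> (\<forall>j\<in>J. c j = (0::real)))"
  using assms(1,2)
proof (induction I rule: finite_induct)
  case empty
  then show ?case by auto
next
  case (insert i I)
  have "\<And>i. i \<in> I \<Longrightarrow> p i \<in> S" using insert.prems by blast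
  from insert.IH[OF this] obtain v where v: "\<And>i. i \<in> I \<Longrightarrow> v i \<in> S \<and> dist (v i) (p i) < \<eta>"
    and ind0: "\<forall>J c. J \<subseteq> I \<longrightarrow> card J \<le> m \<longrightarrow> (\<Sum>j\<in>J. c j *\<^sub>R v j) = 0 \<longrightarrow> (\<forall>j\<in>J. c j = (0::real))"
    by auto
  have ind: "c j = 0" if "J \<subseteq> I" "card J \<le> m" "(\<Sum>j\<in>J. c j *\<^sub>R v j) = 0" "j \<in> J" for J c j
    using ind0[rule_format, OF that] .
  let ?\<T> = "(\<lambda>J. span (v ` J)) ` {J. J \<subseteq> I \<and> card J < m}"
  have "finite ?\<T>" using insert.hyps by simp
  moreover have "\<not> S \<subseteq> T" if T: "T \<in> ?\<T>" for T
  proof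
    assume ST: "S \<subseteq> T"
    obtain J where J: "J \<subseteq> I" "card J < m" "T = span (v ` J)" using T by blast
    have fin: "finite J" using J insert.hyps finite_subset by blast
    have "dim S \<le> card (v ` J)" using ST J fin v by (intro span_card_ge_dim) auto
    also have "\<dots> \<le> card J" using fin by (rule card_image_le)
    finally show False using J S by simp
  qed
  ultimately obtain u where u: "u \<in> S" "dist u (p i) < \<eta>" "u \<notin> \<Union>?\<T>"
    using subspace_avoid_finite_union[of ?\<T> S "p i" \<eta>] S \<eta> insert.prems by (auto simp: subspace_span)
  define v' where "v' = v(i := u)"
  have same: "(\<Sum>j\<in>J. c j *\<^sub>R v' j) = (\<Sum>j\<in>J. c j *\<^sub>R v j)" if "J \<subseteq> I" for J c
    using that insert.hyps by (intro sum.cong) (auto simp: v'_def)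
  have "c j = 0" if J: "J \<subseteq> insert i I" "card J \<le> m" "(\<Sum>j\<in>J. c j *\<^sub>R v' j) = 0" "j \<in> J" for J c j
  proof (cases "i \<in> J")
    case False
    then show ?thesis using J ind[of J c j] same[of J c] by auto
  next
    case True
    define K where "K = J - {i}"
    have K: "J = insert i K" "i \<notin> K" "K \<subseteq> I" using True J by (auto simp: K_def)
    then have fin: "finite K" using insert.hyps finite_subset by blast
    then have card: "card K < m" using J K by simp
    have eq: "c i *\<^sub>R u + (\<Sum>j\<in>K. c j *\<^sub>R v j) = 0"
      using J(3) K fin same[of K c] by (simp add: v'_def)
    \<comment> \<open>A nonzero coefficient would put the new vector \<open>u\<close> into the span
      of fewer than \<open>m\<close> earlier ones, which its choice excludes.\<close>
    have ci: "c i = 0"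
    proof (rule ccontr)
      assume nz: "c i \<noteq> 0"
      have "u = (- 1 / c i) *\<^sub>R (\<Sum>j\<in>K. c j *\<^sub>R v j)"
      proof -
        have "c i *\<^sub>R u = - (\<Sum>j\<in>K. c j *\<^sub>R v j)"
          using eq by (simp add: eq_neg_iff_add_eq_0)
        then have "(1 / c i) *\<^sub>R (c i *\<^sub>R u) = (1 / c i) *\<^sub>R (- (\<Sum>j\<in>K. c j *\<^sub>R v j))"
          by (rule arg_cong)
        then show ?thesis using nz by simp
      qed
      also have "\<dots> \<in> span (v ` K)"
        by (intro span_scale span_sum span_base) auto
      finally show False using u(3) K(3) card by blast
    qed
    then show ?thesis using eq ind[of K c j] K card J(4) by auto
  qed
  moreover have "\<forall>j\<in>insert i I. v' j \<in> S \<and> dist (v' j) (p j) < \<eta>"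
    using v u by (auto simp: v'_def)
  ultimately show ?case by blast
qed

text \<open>
  Map \<open>X\<close> into the nerve of a fine cover of order \<open>m\<close>, with vertices in general position: points
  with the same image satisfy a linear relation between at most \<open>2 * m\<close> vertices.
\<close>

lemma approximation_by_small_fibres:
  fixes X :: "'a::metric_space set" and S :: "'b::euclidean_space set"
  assumes X: "compact X" "refinements_of_order_le (top_of_set X) m"
    and S: "subspace S" "2 * m \<le> dim S"
    and g: "continuous_on X g" "g ` X \<subseteq> S" and \<eta>: "0 < \<eta>" and \<epsilon>: "0 < \<epsilon>"
  obtains h where "continuous_on X h" "h ` X \<subseteq> S" "\<And>x. x \<in> X \<Longrightarrow> dist (h x) (g x) < \<eta>"
    "\<And>x y. x \<in> X \<Longrightarrow> y \<in> X \<Longrightarrow> h x = h y \<Longrightarrow> dist x y < \<epsilon>"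
proof -
  have "uniformly_continuous_on X g" using compact_uniformly_continuous g X by blast
  moreover have "0 < \<eta> / 3" using \<eta> by simp
  ultimately obtain \<delta>' where \<delta>': "0 < \<delta>'" "\<And>x y. x \<in> X \<Longrightarrow> y \<in> X \<Longrightarrow> dist y x < \<delta>' \<Longrightarrow> dist (g y) (g x) < \<eta> / 3"
    unfolding uniformly_continuous_on_def by blast
  \<comment> \<open>The mesh \<open>\<delta>\<close> serves twice: for the oscillation of
    \<open>g\<close> on members of the cover, and for the size of the fibres of
    \<open>h\<close>.\<close>
  define \<delta> where "\<delta> = min \<delta>' \<epsilon>"
  have \<delta>: "0 < \<delta>" using \<delta>' \<epsilon> by (simp add: \<delta>_def)
  have "X \<subseteq> (\<Union>c\<in>X. ball c (\<delta> / 2))" using \<delta> by auto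
  then obtain D where D: "D \<subseteq> X" "finite D" "X \<subseteq> (\<Union>c\<in>D. ball c (\<delta> / 2))"
    by (rule compactE_image[OF X(1) open_ball])
  let ?\<U> = "(\<lambda>c. X \<inter> ball c (\<delta> / 2)) ` D"
  have "finite ?\<U> \<and> (\<forall>U\<in>?\<U>. openin (top_of_set X) U) \<and> \<Union>?\<U> = topspace (top_of_set X)"
    using D by (auto simp: openin_open)
  then have "\<exists>\<V>. finite \<V> \<and> (\<forall>V\<in>\<V>. openin (top_of_set X) V) \<and> \<Union>\<V> = topspace (top_of_set X) \<and>
      (\<forall>V\<in>\<V>. \<exists>U\<in>?\<U>. V \<subseteq> U) \<and> (\<forall>x\<in>topspace (top_of_set X). card {V \<in> \<V>. x \<in> V} \<le> m)"
    using X(2)[unfolded refinements_of_order_le_def, THEN spec, of ?\<U>] by (rule rev_mp)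
  then obtain \<V>0 where \<V>0: "finite \<V>0" "\<forall>V\<in>\<V>0. openin (top_of_set X) V" "\<Union>\<V>0 = X"
    "\<forall>V\<in>\<V>0. \<exists>U\<in>?\<U>. V \<subseteq> U" "\<forall>x\<in>X. card {V \<in> \<V>0. x \<in> V} \<le> m"
    by (elim exE conjE) (simp only: topspace_euclidean_subtopology)
  \<comment> \<open>Discarding the empty set allows a sample point \<open>z V\<close> in every
    member, and makes \<open>W\<close> injective on the cover since each \<open>V\<close> is
    recovered from \<open>W V\<close>.\<close>
  define \<V> where "\<V> = \<V>0 - {{}}"
  have fin: "finite \<V>" and covV: "\<Union>\<V> = X" using \<V>0 by (auto simp: \<V>_def)
  have order: "card {V \<in> \<V>. x \<in> V} \<le> m" if "x \<in> X" for x
  proof -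
    have "card {V \<in> \<V>. x \<in> V} \<le> card {V \<in> \<V>0. x \<in> V}"
      using \<V>0(1) by (intro card_mono) (auto simp: \<V>_def)
    then show ?thesis using \<V>0(5) that by fastforce
  qed
  have mesh: "dist x y < \<delta>" if "V \<in> \<V>" "x \<in> V" "y \<in> V" for V x y
  proof -
    have "V \<in> \<V>0" using that by (simp add: \<V>_def)
    then obtain c where "V \<subseteq> ball c (\<delta> / 2)" using \<V>0(4) by blast
    then have "dist c x < \<delta> / 2" "dist c y < \<delta> / 2" using that by auto
    then show ?thesis by (metis dist_commute dist_triangle_half_l)
  qed
  have "\<forall>V\<in>\<V>. \<exists>W. open W \<and> V = X \<inter> W"
    using \<V>0(2) by (auto simp: \<V>_def openin_open)
  then obtain W where W: "\<And>V. V \<in> \<V> \<Longrightarrow> open (W V)" "\<And>V. V \<in> \<V> \<Longrightarrow> V = X \<inter> W V"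
    by metis
  have "\<forall>V\<in>\<V>. \<exists>x. x \<in> V" by (auto simp: \<V>_def)
  then obtain z where z: "\<And>V. V \<in> \<V> \<Longrightarrow> z V \<in> V" by metis
  have zX: "V \<in> \<V> \<Longrightarrow> z V \<in> X" for V using z covV by blast
  have injW: "inj_on W \<V>" by (metis W(2) inj_onI)
  have finW: "finite (W ` \<V>)" using fin by simp
  obtain \<Phi> :: "'a set \<Rightarrow> 'a \<Rightarrow> real" where \<Phi>:
    "\<And>U. U \<in> W ` \<V> \<Longrightarrow> continuous_on X (\<Phi> U) \<and> (\<forall>x\<in>X. 0 \<le> \<Phi> U x)"
    "\<And>x U. U \<in> W ` \<V> \<Longrightarrow> x \<in> X \<Longrightarrow> x \<notin> U \<Longrightarrow> \<Phi> U x = 0"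
    "\<And>x. x \<in> X \<Longrightarrow> supp_sum (\<lambda>U. \<Phi> U x) (W ` \<V>) = 1"
  proof (rule subordinate_partition_of_unity[of X "W ` \<V>"])
    show "X \<subseteq> \<Union>(W ` \<V>)"
    proof
      fix x assume "x \<in> X"
      then obtain V where "V \<in> \<V>" "x \<in> V" using covV by blast
      then show "x \<in> \<Union>(W ` \<V>)" using W(2) by blast
    qed
    show "open T" if "T \<in> W ` \<V>" for T using that W(1) by auto
    show "\<exists>V. open V \<and> x \<in> V \<and> finite {U \<in> W ` \<V>. U \<inter> V \<noteq> {}}" for x
      using finW by (intro exI[of _ UNIV]) auto
  qed (rule that, assumption+)
  define \<phi> where "\<phi> V = \<Phi> (W V)" for V
  have \<phi>cont: "V \<in> \<V> \<Longrightarrow> continuous_on X (\<phi> V)" for V using \<Phi>(1) by (simp add: \<phi>_def)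
  have \<phi>pos: "V \<in> \<V> \<Longrightarrow> x \<in> X \<Longrightarrow> 0 \<le> \<phi> V x" for V x using \<Phi>(1) by (simp add: \<phi>_def)
  have \<phi>supp: "V \<in> \<V> \<Longrightarrow> x \<in> X \<Longrightarrow> x \<notin> V \<Longrightarrow> \<phi> V x = 0" for V x
    using \<Phi>(2) W(2) by (simp add: \<phi>_def) blast
  have \<phi>sum: "(\<Sum>V\<in>\<V>. \<phi> V x) = 1" if "x \<in> X" for x
  proof -
    have "supp_sum (\<lambda>U. \<Phi> U x) (W ` \<V>) = (\<Sum>U\<in>W ` \<V>. \<Phi> U x)"
      unfolding supp_sum_def support_on_def using finW
      by (intro sum.mono_neutral_left) auto
    also have "\<dots> = (\<Sum>V\<in>\<V>. \<phi> V x)"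
      using injW by (simp add: sum.reindex \<phi>_def)
    finally show ?thesis using \<Phi>(3)[OF that] by simp
  qed
  have "\<And>V. V \<in> \<V> \<Longrightarrow> g (z V) \<in> S" using zX g(2) by blast
  moreover have "0 < \<eta> / 3" using \<eta> by simp
  ultimately obtain v where v0: "\<forall>V\<in>\<V>. v V \<in> S \<and> dist (v V) (g (z V)) < \<eta> / 3"
    and ind0: "\<forall>J c. J \<subseteq> \<V> \<longrightarrow> card J \<le> 2 * m \<longrightarrow> (\<Sum>j\<in>J. c j *\<^sub>R v j) = 0 \<longrightarrow> (\<forall>j\<in>J. c j = (0::real))"
    using general_position[OF fin _ S, of "\<lambda>V. g (z V)" "\<eta> / 3"] by blast
  have v: "V \<in> \<V> \<Longrightarrow> v V \<in> S" "V \<in> \<V> \<Longrightarrow> dist (v V) (g (z V)) < \<eta> / 3" for V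
    using v0 by blast+
  have ind: "c V = 0" if "J \<subseteq> \<V>" "card J \<le> 2 * m" "(\<Sum>j\<in>J. c j *\<^sub>R v j) = 0" "V \<in> J" for J c V
    using ind0[rule_format, OF that] .
  define h where "h x = (\<Sum>V\<in>\<V>. \<phi> V x *\<^sub>R v V)" for x
  show thesis
  proof
    show "continuous_on X h" unfolding h_def by (intro continuous_intros \<phi>cont)
    show "h ` X \<subseteq> S"
      unfolding h_def using S v by (auto intro!: subspace_sum subspace_scale)
    show "dist (h x) (g x) < \<eta>" if x: "x \<in> X" for x
    proof -
      \<comment> \<open>Because the weights sum to 1, the error is an average of
        \<open>v V - g x\<close> over the members containing \<open>x\<close>. Each term is below
        \<open>2 * \<eta> / 3\<close>: one third for moving the vertex, one third for the
        oscillation of \<open>g\<close>.\<close>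
      have "h x - g x = (\<Sum>V\<in>\<V>. \<phi> V x *\<^sub>R (v V - g x))"
        using \<phi>sum[OF x] by (simp add: h_def scaleR_diff_right sum_subtractf flip: scaleR_sum_left)
      then have "norm (h x - g x) \<le> (\<Sum>V\<in>\<V>. norm (\<phi> V x *\<^sub>R (v V - g x)))"
        by (simp only: norm_sum)
      also have "\<dots> \<le> (\<Sum>V\<in>\<V>. \<phi> V x * (2 * \<eta> / 3))"
      proof (rule sum_mono)
        fix V assume V: "V \<in> \<V>"
        show "norm (\<phi> V x *\<^sub>R (v V - g x)) \<le> \<phi> V x * (2 * \<eta> / 3)"
        proof (cases "x \<in> V")
          case True
          have "dist (g (z V)) (g x) < \<eta> / 3"
            using \<delta>'(2)[OF x zX[OF V]] mesh[OF V z[OF V] True] by (simp add: \<delta>_def)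
          then have "norm (v V - g x) \<le> 2 * \<eta> / 3"
            using v(2)[OF V] dist_triangle[of "v V" "g x" "g (z V)"] by (simp add: dist_norm)
          then have "\<phi> V x * norm (v V - g x) \<le> \<phi> V x * (2 * \<eta> / 3)"
            by (rule mult_left_mono) (rule \<phi>pos[OF V x])
          then show ?thesis using \<phi>pos[OF V x] by (simp only: norm_scaleR abs_of_nonneg)
        next
          case False
          then show ?thesis using \<phi>supp[OF V x] by simp
        qed
      qed
      also have "\<dots> = 2 * \<eta> / 3"
        unfolding sum_distrib_right[symmetric] \<phi>sum[OF x] by simp
      finally show ?thesis using \<eta> by (simp add: dist_norm)
    qed
    show "dist x y < \<epsilon>" if x: "x \<in> X" and y: "y \<in> X" and eq: "h x = h y" for x y
    proof -
      \<comment> \<open>Only members containing \<open>x\<close> or \<open>y\<close> carry weight,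
        at most \<open>m\<close> for each point. Independence of these vertices makes the weights of
        \<open>x\<close> and \<open>y\<close> agree, so a member with positive weight contains both
        points.\<close>
      let ?J = "{V \<in> \<V>. x \<in> V} \<union> {V \<in> \<V>. y \<in> V}"
      have "card ?J \<le> 2 * m"
        using card_Un_le[of "{V \<in> \<V>. x \<in> V}" "{V \<in> \<V>. y \<in> V}"] order[OF x] order[OF y] by linarith
      moreover have "(\<Sum>V\<in>?J. (\<phi> V x - \<phi> V y) *\<^sub>R v V) = (\<Sum>V\<in>\<V>. (\<phi> V x - \<phi> V y) *\<^sub>R v V)"
        using fin \<phi>supp x y by (intro sum.mono_neutral_left) auto
      moreover have "\<dots> = h x - h y"
        by (simp add: h_def scaleR_diff_left sum_subtractf)
      ultimately have same: "\<phi> V x = \<phi> V y" if "V \<in> ?J" for V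
        using ind[of ?J "\<lambda>V. \<phi> V x - \<phi> V y" V] that eq by auto
      obtain V where V: "V \<in> \<V>" "\<phi> V x \<noteq> 0"
        using \<phi>sum[OF x] by (metis sum.neutral zero_neq_one)
      then have "x \<in> V" using \<phi>supp x by blast
      then have "\<phi> V y \<noteq> 0" using same V by auto
      then have "y \<in> V" using \<phi>supp V y by blast
      then show ?thesis using mesh[OF V(1) \<open>x \<in> V\<close>] by (simp add: \<delta>_def)
    qed
  qed
qed

text \<open>The embedding is a uniform limit of maps with ever smaller fibres. Each stage fixes a
  tolerance within which all later maps still separate the points it separates, as in a proof by the
  Baire category theorem.\<close>

theorem menger_noebeling:
  fixes X :: "'a::metric_space set" and S :: "'b::euclidean_space set"
  assumes X: "compact X" "refinements_of_order_le (top_of_set X) m"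
    and S: "subspace S" "2 * m \<le> dim S"
  obtains e where "continuous_on X e" "e ` X \<subseteq> S" "inj_on e X"
proof -
  \<comment> \<open>The second component of \<open>p\<close> is a tolerance: two points at distance
    at least \<open>1 / real (Suc n)\<close> remain apart when both images move by at most that
    amount.\<close>
  define good where "good n p \<longleftrightarrow> continuous_on X (fst p) \<and> fst p ` X \<subseteq> S \<and> 0 < snd p \<and> snd p \<le> (1/2)^n \<and>
      (\<forall>x\<in>X. \<forall>y\<in>X. 1 / real (Suc n) \<le> dist x y \<longrightarrow> 2 * snd p < dist (fst p x) (fst p y))"
    for n and p :: "('a \<Rightarrow> 'b) \<times> real"
  \<comment> \<open>Each step moves points by less than half the current tolerance and at least
    halves that tolerance, so the total later movement is bounded by the current tolerance.\<close>
  define near where "near p p' \<longleftrightarrow> (\<forall>x\<in>X. dist (fst p' x) (fst p x) < snd p / 2) \<and> snd p' \<le> snd p / 2"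
    for p p' :: "('a \<Rightarrow> 'b) \<times> real"
  have improve: "\<exists>p'. good n p' \<and> near p p'"
    if p: "continuous_on X (fst p)" "fst p ` X \<subseteq> S" "0 < snd p" for n p
  proof -
    let ?\<epsilon> = "1 / real (Suc n)"
    obtain h where h: "continuous_on X h" "h ` X \<subseteq> S" "\<And>x. x \<in> X \<Longrightarrow> dist (h x) (fst p x) < snd p / 2"
      "\<And>x y. x \<in> X \<Longrightarrow> y \<in> X \<Longrightarrow> h x = h y \<Longrightarrow> dist x y < ?\<epsilon>"
      using approximation_by_small_fibres[OF X S p(1,2), of "snd p / 2" ?\<epsilon>] p(3) by auto
    let ?C = "{z \<in> X \<times> X. ?\<epsilon> \<le> dist (fst z) (snd z)}"
    have "compact ((X \<times> X) \<inter> {z. ?\<epsilon> \<le> dist (fst z) (snd z)})"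
      by (intro compact_Int_closed compact_Times X closed_Collect_le continuous_intros)
    then have cC: "compact ?C" by (simp add: Int_def)
    have contd: "continuous_on ?C (\<lambda>z. dist (h (fst z)) (h (snd z)))"
      by (intro continuous_intros continuous_on_compose2[OF h(1)]) auto
    obtain r where r: "0 < r" "\<And>x y. x \<in> X \<Longrightarrow> y \<in> X \<Longrightarrow> ?\<epsilon> \<le> dist x y \<Longrightarrow> r \<le> dist (h x) (h y)"
    proof (cases "?C = {}")
      case True
      then show ?thesis using that[of 1] by auto
    next
      case False
      obtain z where z: "z \<in> ?C" "\<forall>y\<in>?C. dist (h (fst z)) (h (snd z)) \<le> dist (h (fst y)) (h (snd y))"
        using continuous_attains_inf[OF cC False contd] by blast
      show ?thesis
      proof (rule that)
        show "0 < dist (h (fst z)) (h (snd z))"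
          using z(1) h(4)[of "fst z" "snd z"] by auto
        show "dist (h (fst z)) (h (snd z)) \<le> dist (h x) (h y)"
          if "x \<in> X" "y \<in> X" "?\<epsilon> \<le> dist x y" for x y
          using z(2)[rule_format, of "(x, y)"] that by auto
      qed
    qed
    \<comment> \<open>The bound \<open>r / 3\<close> ensures \<open>2 * \<eta> < r\<close>, where
      \<open>r\<close> is the least separation achieved by \<open>h\<close> on pairs at distance at
      least \<open>?\<epsilon>\<close>.\<close>
    define \<eta> where "\<eta> = min (min (snd p / 2) ((1/2)^n)) (r / 3)"
    have "0 < \<eta>" "\<eta> \<le> snd p / 2" "\<eta> \<le> (1/2)^n" "\<eta> \<le> r / 3"
      using p(3) r(1) by (auto simp: \<eta>_def)
    moreover have "2 * \<eta> < dist (h x) (h y)" if "x \<in> X" "y \<in> X" "?\<epsilon> \<le> dist x y" for x y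
      using r(2)[OF that] r(1) \<open>\<eta> \<le> r / 3\<close> by linarith
    ultimately have "good n (h, \<eta>) \<and> near p (h, \<eta>)"
      unfolding good_def near_def using h by auto
    then show ?thesis by blast
  qed
  have "\<exists>f. \<forall>n. good n (f n) \<and> near (f n) (f (Suc n))"
  proof (rule dependent_nat_choice)
    show "\<exists>p. good 0 p"
      using improve[of "(\<lambda>x. 0, 1)" 0] subspace_0[OF S(1)] by auto
    show "\<exists>p'. good (Suc n) p' \<and> near p p'" if "good n p" for p n
      using improve[of p "Suc n"] that unfolding good_def by blast
  qed
  then obtain f where f: "\<And>n. good n (f n)" "\<And>n. near (f n) (f (Suc n))" by blast
  define g where "g n = fst (f n)" for n
  define \<eta> where "\<eta> n = snd (f n)" for n
  have contg: "continuous_on X (g n)" and gS: "x \<in> X \<Longrightarrow> g n x \<in> S"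
    and \<eta>pos: "0 < \<eta> n" and \<eta>le: "\<eta> n \<le> (1/2)^n" for n x
    using f(1)[of n] by (auto simp: good_def g_def \<eta>_def)
  have sep: "2 * \<eta> n < dist (g n x) (g n y)" if "x \<in> X" "y \<in> X" "1 / real (Suc n) \<le> dist x y" for n x y
    using f(1)[of n] that by (auto simp: good_def g_def \<eta>_def)
  have gstep: "x \<in> X \<Longrightarrow> dist (g (Suc n) x) (g n x) < \<eta> n / 2" and \<eta>step: "\<eta> (Suc n) \<le> \<eta> n / 2" for n x
    using f(2)[of n] by (auto simp: near_def g_def \<eta>_def)
  \<comment> \<open>The estimate telescopes: half the tolerance at a step is at most the drop in
    tolerance to the next step.\<close>
  have tail: "dist (g (n + j) x) (g n x) \<le> \<eta> n - \<eta> (n + j)" if x: "x \<in> X" for n j x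
  proof (induction j)
    case 0
    then show ?case by simp
  next
    case (Suc j)
    then show ?case
      using gstep[OF x, of "n + j"] \<eta>step[of "n + j"]
        dist_triangle[of "g (Suc (n + j)) x" "g n x" "g (n + j) x"] by simp
  qed
  have tail': "dist (g k x) (g n x) \<le> \<eta> n" if "x \<in> X" "n \<le> k" for n k x
    using tail[OF that(1), of n "k - n"] that \<eta>pos[of k] by simp
  have \<eta>0: "\<eta> \<longlonglongrightarrow> 0"
    by (rule tendsto_sandwich[of "\<lambda>_. 0" _ _ "\<lambda>n. (1/2)^n"])
      (use \<eta>pos \<eta>le in \<open>auto intro!: eventuallyI less_imp_le LIMSEQ_realpow_zero\<close>)
  have "\<exists>l. (\<lambda>n. g n x) \<longlonglongrightarrow> l" if x: "x \<in> X" for x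
  proof -
    have "Cauchy (\<lambda>n. g n x)"
    proof (rule metric_CauchyI)
      fix r :: real assume "0 < r"
      then obtain N where N: "\<eta> N < r / 2"
        using order_tendstoD(2)[OF \<eta>0, of "r / 2"] by (auto simp: eventually_sequentially)
      have "dist (g a x) (g b x) < r" if "a \<ge> N" "b \<ge> N" for a b
        using tail'[OF x that(1)] tail'[OF x that(2)] N dist_triangle2[of "g a x" "g b x" "g N x"] by simp
      then show "\<exists>M. \<forall>a\<ge>M. \<forall>b\<ge>M. dist (g a x) (g b x) < r" by blast
    qed
    then show ?thesis by (simp add: Cauchy_convergent_iff convergent_def)
  qed
  then obtain e where e: "\<And>x. x \<in> X \<Longrightarrow> (\<lambda>n. g n x) \<longlonglongrightarrow> e x" by metis
  have close: "dist (e x) (g n x) \<le> \<eta> n" if x: "x \<in> X" for x n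
  proof (rule tendsto_upperbound)
    show "(\<lambda>k. dist (g k x) (g n x)) \<longlonglongrightarrow> dist (e x) (g n x)" by (intro tendsto_intros e x)
    show "\<forall>\<^sub>F k in sequentially. dist (g k x) (g n x) \<le> \<eta> n"
      using tail'[OF x] eventually_sequentially by blast
  qed simp
  have "uniform_limit X g e sequentially"
  proof (rule uniform_limitI)
    fix r :: real assume "0 < r"
    then have "\<forall>\<^sub>F n in sequentially. \<eta> n < r" using order_tendstoD(2)[OF \<eta>0] by blast
    then show "\<forall>\<^sub>F n in sequentially. \<forall>x\<in>X. dist (g n x) (e x) < r"
    proof eventually_elim
      case (elim n)
      then show ?case using close by (metis dist_commute order_le_less_trans)
    qed
  qed
  then have "continuous_on X e"
    using contg by (intro uniform_limit_theorem) auto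
  moreover have "e ` X \<subseteq> S"
    using closed_sequentially[OF closed_subspace[OF S(1)] _ e] gS by blast
  moreover have "inj_on e X"
  proof (rule inj_onI, rule ccontr)
    fix x y assume x: "x \<in> X" and y: "y \<in> X" and eq: "e x = e y" and "x \<noteq> y"
    then obtain n where n: "1 / real (Suc n) < dist x y"
      using nat_approx_posE[of "dist x y"] by auto
    then have "2 * \<eta> n < dist (g n x) (g n y)" by (intro sep x y) simp
    moreover have "dist (g n x) (g n y) \<le> dist (e x) (g n x) + dist (e y) (g n y)"
      using eq dist_triangle3[of "g n x" "g n y" "e x"] by simp
    ultimately show False using close[OF x, of n] close[OF y, of n] by simp
  qed
  ultimately show ?thesis by (rule that)
qed

subsection \<open>Embedding the dynamics\<close>

text \<open>
  \<open>P\<close> projects onto the first of two factors of equal dimension, and \<open>\<sigma>\<close> swaps the factors.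
\<close>

locale swapped_splitting =
  fixes P \<sigma> :: "'b::euclidean_space \<Rightarrow> 'b"
  assumes linear_P: "linear P" and P_P: "P (P z) = P z"
    and norm_P: "norm (P z) \<le> norm z" and norm_diff_P: "norm (z - P z) \<le> norm z"
    and linear_\<sigma>: "linear \<sigma>" and \<sigma>_\<sigma>: "\<sigma> (\<sigma> z) = z" and norm_\<sigma>: "norm (\<sigma> z) = norm z"
    and \<sigma>_P: "\<sigma> (P z) = \<sigma> z - P (\<sigma> z)"
begin

lemma continuous_on_P: "continuous_on S P"
  using linear_P by (simp add: linear_conv_bounded_linear linear_continuous_on)

lemma continuous_on_\<sigma>: "continuous_on S \<sigma>"
  using linear_\<sigma> by (simp add: linear_conv_bounded_linear linear_continuous_on)

lemma P_\<sigma>_P: "P (\<sigma> (P z)) = 0"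
  using linear_P by (simp add: \<sigma>_P linear_diff P_P)

text \<open>
  Klee's trick: two shears send \<open>(a, 0)\<close> to \<open>(a, f a)\<close> and then to \<open>(0, f a)\<close>, and \<open>\<sigma>\<close> swaps
  the factors. The Tietze extensions are chosen bounded to control the norm.
\<close>

lemma klee_extension:
  assumes A: "compact A" "\<And>a. a \<in> A \<Longrightarrow> P a = a" and f: "homeomorphism A A f f'"
  obtains h h' C where "homeomorphism UNIV UNIV h h'" "\<And>a. a \<in> A \<Longrightarrow> h a = f a"
    "\<And>z. norm (h z) \<le> norm z + C"
proof -
  obtain C where C: "0 < C" "\<And>a. a \<in> A \<Longrightarrow> norm a \<le> C"
    using compact_imp_bounded[OF A(1)] bounded_pos by blast
  have clA: "closedin (top_of_set UNIV) A" using A by (simp add: compact_imp_closed)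
  have fA: "f ` A = A" "f' ` A = A" and contf: "continuous_on A f" "continuous_on A f'"
    and ff: "\<And>a. a \<in> A \<Longrightarrow> f' (f a) = a"
    using f by (auto simp: homeomorphism_def)
  obtain g where g: "continuous_on UNIV g" "\<And>a. a \<in> A \<Longrightarrow> g a = f a" "\<And>z. norm (g z) \<le> C"
    by (rule Tietze[OF contf(1) clA, of C]) (use C fA in auto)
  obtain g' where g': "continuous_on UNIV g'" "\<And>a. a \<in> A \<Longrightarrow> g' a = f' a" "\<And>z. norm (g' z) \<le> C"
    by (rule Tietze[OF contf(2) clA, of C]) (use C fA in force)+
  \<comment> \<open>\<open>s\<close> depends on \<open>P z\<close> alone and \<open>s'\<close> on
    \<open>P (\<sigma> z)\<close> alone, and neither shear changes the argument it depends on. Hence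
    both have Lipschitz constant 0 along fibres.\<close>
  define s where "s z = \<sigma> (P (g (P z)))" for z
  define s' where "s' z = - P (g' (P (\<sigma> z)))" for z
  have "continuous_on UNIV s"
    unfolding s_def
    by (intro continuous_on_compose2[OF continuous_on_\<sigma>] continuous_on_compose2[OF continuous_on_P]
       continuous_on_compose2[OF g(1)] continuous_on_P) auto
  then obtain h1 where h1: "homeomorphism UNIV UNIV (\<lambda>z. z + s z) h1"
    using shear_homeomorphism[OF linear_P, of s 0] P_\<sigma>_P by (auto simp: s_def)
  have lin: "linear (\<lambda>z. P (\<sigma> z))"
    using linear_compose[OF linear_\<sigma> linear_P] by (simp add: o_def)
  have "continuous_on UNIV s'"
    unfolding s'_def
    by (intro continuous_on_minus continuous_on_compose2[OF continuous_on_P] continuous_on_\<sigma>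
       continuous_on_compose2[OF g'(1)]) auto
  moreover have "P (\<sigma> (s' z)) = 0" for z
    using P_\<sigma>_P linear_\<sigma> linear_P by (simp add: s'_def linear_neg)
  ultimately obtain h2 where h2: "homeomorphism UNIV UNIV (\<lambda>z. z + s' z) h2"
    using shear_homeomorphism[OF lin, of s' 0] by (auto simp: s'_def)
  have h3: "homeomorphism UNIV UNIV \<sigma> \<sigma>"
    by (rule homeomorphismI) (auto simp: \<sigma>_\<sigma> continuous_on_\<sigma>)
  let ?h = "\<sigma> \<circ> ((\<lambda>z. z + s' z) \<circ> (\<lambda>z. z + s z))"
  have "homeomorphism UNIV UNIV ?h ((h1 \<circ> h2) \<circ> \<sigma>)"
    by (rule homeomorphism_compose[OF homeomorphism_compose[OF h1 h2] h3])
  moreover have "?h a = f a" if a: "a \<in> A" for a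
  proof -
    have fa: "f a \<in> A" using a fA by blast
    have "s a = \<sigma> (f a)" using a fa A g by (simp add: s_def)
    moreover have "P (\<sigma> (a + \<sigma> (f a))) = f a"
      using P_\<sigma>_P[of a] A(2)[OF a] A(2)[OF fa] linear_\<sigma> linear_P \<sigma>_\<sigma> by (simp add: linear_add)
    then have "s' (a + \<sigma> (f a)) = - a"
      using g'(2)[OF fa] ff[OF a] A(2)[OF a] by (simp add: s'_def)
    ultimately show ?thesis using \<sigma>_\<sigma> by simp
  qed
  moreover have "norm (?h z) \<le> norm z + 2 * C" for z
  proof -
    have "norm (s w) \<le> C" "norm (s' w) \<le> C" for w
      unfolding s_def s'_def norm_\<sigma> norm_minus_cancel using norm_P g(3) g'(3) order_trans by blast+
    then have "norm (z + s z) \<le> norm z + C" "norm (z + s z + s' (z + s z)) \<le> norm (z + s z) + C"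
      by (meson add_left_mono norm_triangle_ineq order_trans)+
    then show ?thesis by (simp add: norm_\<sigma>)
  qed
  ultimately show ?thesis by (rule that)
qed

text \<open>
  First push \<open>e x\<close> to \<open>e x + c \<sigma> (e x)\<close> for a tiny \<open>c\<close>; now the second factor determines \<open>x\<close>, so
  the homotopy \<open>H\<close> in the first factor becomes an isotopy.
\<close>

lemma squeeze_into_ball:
  fixes e :: "'a::metric_space \<Rightarrow> 'b" and H :: "real \<Rightarrow> 'a \<Rightarrow> 'b"
  assumes X: "compact X" "X \<noteq> {}" and e: "continuous_on X e" "inj_on e X" "\<And>x. x \<in> X \<Longrightarrow> P (e x) = e x"
    and H: "continuous_on ({0..1} \<times> X) (\<lambda>(t, x). H t x)"
    and H0: "\<And>x. x \<in> X \<Longrightarrow> H 0 x = e x" and H1: "\<And>x. x \<in> X \<Longrightarrow> H 1 x = q"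
    and PH: "\<And>t x. 0 \<le> t \<Longrightarrow> t \<le> 1 \<Longrightarrow> x \<in> X \<Longrightarrow> P (H t x) = H t x"
    and W: "open W" "\<And>t x. 0 \<le> t \<Longrightarrow> t \<le> 1 \<Longrightarrow> x \<in> X \<Longrightarrow> H t x \<in> W" and \<delta>: "0 < \<delta>"
  obtains h h' where "homeomorphism UNIV UNIV h h'" "\<And>x. x \<in> X \<Longrightarrow> h (e x) \<in> ball q \<delta>"
    "\<And>z. z \<notin> W \<Longrightarrow> h z = z"
proof -
  let ?K = "(\<lambda>(t, x). H t x) ` ({0..1} \<times> X)"
  have "compact ?K" by (intro compact_continuous_image[OF H] compact_Times X compact_Icc)
  moreover have "?K \<subseteq> W" using W(2) by auto
  ultimately obtain d where d: "0 < d" "(\<Union>y\<in>?K. ball y d) \<subseteq> W"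
    by (rule compact_subset_open_imp_ball_epsilon_subset[OF _ W(1)])
  have near: "H t x + v \<in> W" if "0 \<le> t" "t \<le> 1" "x \<in> X" "norm v < d" for t x v
  proof -
    have "H t x \<in> ?K" using that by (intro image_eqI[of _ _ "(t, x)"]) auto
    moreover have "H t x + v \<in> ball (H t x) d" using that by (simp add: dist_norm)
    ultimately show ?thesis using d(2) by blast
  qed
  have "bounded (e ` X)" by (intro compact_imp_bounded compact_continuous_image e X)
  then obtain M where M: "0 < M" "\<And>x. x \<in> X \<Longrightarrow> norm (e x) \<le> M"
    unfolding bounded_pos by auto
  \<comment> \<open>With this \<open>c\<close> the displacement
    \<open>c *\<^sub>R \<sigma> (e x)\<close> has norm at most half of
    \<open>min d \<delta>\<close>.\<close>
  define c where "c = min d \<delta> / (2 * M)"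
  have c: "0 < c" "c * M < d" "c * M < \<delta>"
    using M(1) d(1) \<delta> by (auto simp: c_def)
  have small: "norm (s *\<^sub>R \<sigma> (e x)) \<le> c * M" if "0 \<le> s" "s \<le> c" "x \<in> X" for s x
    using that M(2)[OF that(3)] c by (auto simp: norm_\<sigma> intro!: mult_mono)
  have small_c: "norm (c *\<^sub>R \<sigma> (e x)) < d" "norm (c *\<^sub>R \<sigma> (e x)) < \<delta>" if "x \<in> X" for x
    using order_le_less_trans[OF small[of c x]] that c by (simp_all only: less_imp_le order_refl)
  have P\<sigma>e: "P (\<sigma> (e x)) = 0" if "x \<in> X" for x
    using P_\<sigma>_P[of "e x"] e(3)[OF that] by simp
  have cont\<sigma>e: "continuous_on ({0..1::real} \<times> X) (\<lambda>z. \<sigma> (e (snd z)))"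
    by (intro continuous_on_compose2[OF continuous_on_\<sigma>] continuous_on_compose2[OF e(1)] continuous_intros) auto
  \<comment> \<open>\<open>G1\<close> moves the second component while the first stays
    \<open>e x\<close>. \<open>G2\<close> starts where \<open>G1\<close> ends and moves the first
    component along \<open>H\<close>, while the second stays
    \<open>c *\<^sub>R \<sigma> (e x)\<close>, which still determines \<open>x\<close>. So the
    isotopy lemma applies with \<open>P\<close> and then with the complementary projection.\<close>
  define G1 where "G1 t x = e x + (t * c) *\<^sub>R \<sigma> (e x)" for t x
  define G2 where "G2 t x = H t x + c *\<^sub>R \<sigma> (e x)" for t x
  have PG1: "P (G1 t x) = e x" if "x \<in> X" for t x
    using that e(3) P\<sigma>e linear_P by (simp add: G1_def linear_add linear_cmul)
  obtain h1 h1' where h1: "homeomorphism UNIV UNIV h1 h1'" "\<And>x. x \<in> X \<Longrightarrow> h1 (G1 0 x) = G1 1 x"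
    "\<And>z. z \<notin> W \<Longrightarrow> h1 z = z"
  proof (rule isotopy_homeomorphism[OF X, of G1 P W])
    show "continuous_on ({0..1} \<times> X) (\<lambda>(t, x). G1 t x)"
      unfolding G1_def case_prod_unfold
      by (intro continuous_intros cont\<sigma>e continuous_on_compose2[OF e(1)]) auto
    show "inj_on (\<lambda>x. P (G1 0 x)) X"
      using e(2) PG1 by (simp add: inj_on_def)
    show "G1 t x \<in> W" if "x \<in> X" "0 \<le> t" "t \<le> 1" for x t
    proof -
      have "t * c \<le> c" using that c by (simp add: mult_left_le_one_le)
      then have "norm ((t * c) *\<^sub>R \<sigma> (e x)) \<le> c * M"
        using small[of "t * c" x] that c by (simp only: mult_nonneg_nonneg less_imp_le)
      then have "norm ((t * c) *\<^sub>R \<sigma> (e x)) < d"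
        using c(2) by (rule order_le_less_trans)
      then show ?thesis using near[of 0 x] that H0 by (simp add: G1_def)
    qed
  qed (use linear_P P_P norm_diff_P PG1 W in auto)
  have QG2: "G2 t x - P (G2 t x) = c *\<^sub>R \<sigma> (e x)" if "x \<in> X" "0 \<le> t" "t \<le> 1" for t x
    using that PH P\<sigma>e linear_P by (simp add: G2_def linear_add linear_cmul)
  obtain h2 h2' where h2: "homeomorphism UNIV UNIV h2 h2'" "\<And>x. x \<in> X \<Longrightarrow> h2 (G2 0 x) = G2 1 x"
    "\<And>z. z \<notin> W \<Longrightarrow> h2 z = z"
  proof (rule isotopy_homeomorphism[OF X, of G2 "\<lambda>z. z - P z" W])
    show "continuous_on ({0..1} \<times> X) (\<lambda>(t, x). G2 t x)"
      using H unfolding G2_def case_prod_unfold by (intro continuous_intros cont\<sigma>e)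
    show "linear (\<lambda>z. z - P z)" by (intro linear_compose_sub linear_id[unfolded id_def] linear_P)
    show "inj_on (\<lambda>x. G2 0 x - P (G2 0 x)) X"
    proof (rule inj_onI)
      fix x y assume x: "x \<in> X" and y: "y \<in> X" and eq: "G2 0 x - P (G2 0 x) = G2 0 y - P (G2 0 y)"
      have "c *\<^sub>R \<sigma> (e x) = c *\<^sub>R \<sigma> (e y)"
        using eq QG2[OF x, of 0] QG2[OF y, of 0] by simp
      then have "\<sigma> (\<sigma> (e x)) = \<sigma> (\<sigma> (e y))" using c by simp
      then show "x = y" using e(2) x y by (simp add: \<sigma>_\<sigma> inj_on_def)
    qed
    show "G2 t x \<in> W" if "x \<in> X" "0 \<le> t" "t \<le> 1" for x t
      unfolding G2_def by (intro near that small_c)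
    show "z - P z - P (z - P z) = z - P z" for z
      using linear_P by (simp add: linear_diff P_P)
    show "norm (z - (z - P z)) \<le> norm z" for z by (simp add: norm_P)
  qed (use QG2 W in auto)
  show thesis
  proof
    show "homeomorphism UNIV UNIV (h2 \<circ> h1) (h1' \<circ> h2')"
      by (rule homeomorphism_compose[OF h1(1) h2(1)])
    show "(h2 \<circ> h1) (e x) \<in> ball q \<delta>" if x: "x \<in> X" for x
    proof -
      have "G1 0 x = e x" "G1 1 x = G2 0 x" using H0[OF x] by (simp_all add: G1_def G2_def)
      then have "(h2 \<circ> h1) (e x) = G2 1 x" using h1(2)[OF x] h2(2)[OF x] by simp
      then show ?thesis using small_c(2)[OF x] H1[OF x] by (simp add: G2_def dist_norm)
    qed
    show "(h2 \<circ> h1) z = z" if "z \<notin> W" for z using h1 h2 that by simp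
  qed
qed

text \<open>The dimension bound lets the first factor alone hold the embedded attractor, from covers
  of order \<open>k + 1\<close>. The second factor remains free for extending the dynamics and for
  the squeeze.\<close>

theorem embedded_dynamics_near_attractor:
  fixes F F' :: "'a::real_normed_vector \<Rightarrow> 'a"
  assumes FF: "homeomorphism UNIV UNIV F F'" and F: "global_attractor F \<A>"
    and dim: "covering_dim (top_of_set \<A>) \<le> ereal (real k)" and k: "2 * k + 2 \<le> dim (range P)"
    and \<epsilon>: "0 < \<epsilon>"
  shows "\<exists>A (e :: 'a \<Rightarrow> 'b) e' f f' A\<^sub>f. homeomorphism \<A> A e e' \<and> homeomorphism UNIV UNIV f f' \<and>
    f ` A = A \<and> (\<forall>x\<in>\<A>. F x = e' (f (e x))) \<and> global_attractor f A\<^sub>f \<and> A \<subseteq> A\<^sub>f \<and> A\<^sub>f \<subseteq> nbhd A \<epsilon>"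
proof -
  have cA: "compact \<A>" and FA: "F ` \<A> = \<A>" using F unfolding global_attractor_def by blast+
  have "\<A> \<noteq> {}" using F by (rule global_attractor_nonempty)
  then obtain p where p: "p \<in> \<A>" by blast
  have S: "subspace (range P)" using linear_P by (simp add: linear_subspace_image)
  have "2 * Suc k \<le> dim (range P)" using k by simp
  then obtain e where e: "continuous_on \<A> e" "e ` \<A> \<subseteq> range P" "inj_on e \<A>"
    by (rule menger_noebeling[OF cA covering_dim_le_refinements[OF dim] S])
  have Pe: "P (e x) = e x" if "x \<in> \<A>" for x
  proof -
    obtain z where "e x = P z" using e(2) \<open>x \<in> \<A>\<close> by blast
    then show ?thesis by (simp add: P_P)
  qed
  define A where "A = e ` \<A>"
  have cptA: "compact A" unfolding A_def by (intro compact_continuous_image e cA)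
  obtain e' where e': "homeomorphism \<A> A e e'"
    using homeomorphism_compact[OF cA e(1) A_def[symmetric] e(3)] by blast
  have e'e: "e' (e x) = x" if "x \<in> \<A>" for x using e' that by (rule homeomorphism_apply1)
  have FFA: "homeomorphism \<A> \<A> F F'"
    by (rule homeomorphism_of_subsets[OF FF _ _ FA]) auto
  have PA: "P a = a" if "a \<in> A" for a using that Pe by (auto simp: A_def)
  have "homeomorphism A A (e \<circ> (F \<circ> e')) ((e \<circ> F') \<circ> e')"
    by (rule homeomorphism_compose[OF homeomorphism_compose[OF homeomorphism_symD[OF e'] FFA] e'])
  from klee_extension[OF cptA PA this] obtain \<phi> \<phi>' C0 where \<phi>: "homeomorphism UNIV UNIV \<phi> \<phi>'"
    "\<And>a. a \<in> A \<Longrightarrow> \<phi> a = (e \<circ> (F \<circ> e')) a" "\<And>z. norm (\<phi> z) \<le> norm z + C0"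
    by blast
  have \<phi>e: "\<phi> (e x) = e (F x)" if "x \<in> \<A>" for x
    using \<phi>(2)[of "e x"] that e'e by (simp add: A_def)
  have \<phi>A: "\<phi> ` A = A"
  proof -
    have "\<phi> ` A = e ` F ` \<A>" unfolding A_def image_image using \<phi>e by (intro image_cong) auto
    then show ?thesis by (simp add: FA A_def)
  qed
  have neA: "A \<noteq> {}" using p by (auto simp: A_def)
  \<comment> \<open>The minimum with 1 keeps \<open>N\<close> bounded whatever
    \<open>\<epsilon>\<close> is; boundedness passes to \<open>W\<close> and then limits the
    displacement by \<open>\<Theta>\<close>.\<close>
  define N where "N = {y. infdist y A < min \<epsilon> 1}"
  have oN: "open N" unfolding N_def by (intro open_Collect_less continuous_intros)
  have AN: "A \<subseteq> N" using \<epsilon> by (auto simp: N_def)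
  have bN: "bounded N"
  proof -
    obtain b where b: "\<And>a. a \<in> A \<Longrightarrow> norm a \<le> b"
      using compact_imp_bounded[OF cptA] unfolding bounded_iff by blast
    have "norm y \<le> b + 1" if "y \<in> N" for y
    proof -
      obtain a where a: "a \<in> A" "infdist y A = dist y a"
        using infdist_attains_inf[OF compact_imp_closed[OF cptA] neA] by blast
      then have "norm (y - a) < 1" using that by (simp add: N_def dist_norm)
      then show ?thesis using b[OF a(1)] norm_triangle_sub[of y a] by linarith
    qed
    then show ?thesis unfolding bounded_iff by blast
  qed
  have contphi: "continuous_on T \<phi>" "continuous_on T \<phi>'" for T
    using \<phi>(1) by (auto simp: homeomorphism_def intro: continuous_on_subset)
  have phiphi: "\<phi>' (\<phi> z) = z" "\<phi> (\<phi>' z) = z" for z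
    using \<phi>(1) by (auto simp: homeomorphism_def)
  \<comment> \<open>\<open>\<phi>\<close> is applied last in \<open>f\<close>, so a point need only
    be brought into \<open>W\<close> to land in \<open>N\<close>. \<open>\<Theta>\<close> will be
    supported in \<open>W\<close>, hence its inverse preserves \<open>W\<close>.\<close>
  define W where "W = \<phi> -` N"
  have oW: "open W" unfolding W_def using oN contphi by (intro open_vimage)
  have AW: "A \<subseteq> W" using \<phi>A AN by (auto simp: W_def)
  have "bounded W"
  proof -
    have "W \<subseteq> \<phi>' ` closure N"
    proof
      fix z assume "z \<in> W"
      then have "\<phi> z \<in> closure N" using closure_subset by (auto simp: W_def)
      then show "z \<in> \<phi>' ` closure N" using phiphi(1)[of z] by (metis image_eqI)
    qed
    moreover have "compact (\<phi>' ` closure N)"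
      using bN by (intro compact_continuous_image contphi) simp
    ultimately show ?thesis using bounded_subset compact_imp_bounded by blast
  qed
  \<comment> \<open>The contraction of the attractor leaves the attractor inside \<open>E\<close>,
    so \<open>e\<close> must be extended before the contraction can be transported; composing with
    \<open>P\<close> keeps it in the first factor.\<close>
  obtain g where g: "continuous_on UNIV g" "\<And>x. x \<in> \<A> \<Longrightarrow> g x = e x"
    using Tietze_compact[OF cA e(1)] by blast
  have contPg: "continuous_on UNIV (\<lambda>x. P (g x))"
    by (rule continuous_on_compose2[OF continuous_on_P g(1)]) auto
  define U where "U = (\<lambda>x. P (g x)) -` W"
  have oU: "open U" unfolding U_def using oW contPg by (intro open_vimage)
  have AU: "\<A> \<subseteq> U" using g(2) Pe AW by (auto simp: U_def A_def)
  obtain H where H: "continuous_on ({0..1} \<times> \<A>) (\<lambda>(t, x). H t x)"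
    "\<And>x. H 0 x = x" "\<And>x. H 1 x = p"
    "\<And>t x. 0 \<le> t \<Longrightarrow> t \<le> (1::real) \<Longrightarrow> x \<in> \<A> \<Longrightarrow> H t x \<in> U"
    using global_attractor_contractible_nearby[OF FF F oU AU p] by blast
  define q where "q = e p"
  have "q \<in> W" using AW p by (auto simp: q_def A_def)
  then obtain \<delta>0 where \<delta>0: "0 < \<delta>0" "ball q \<delta>0 \<subseteq> W" using oW open_contains_ball by blast
  define \<delta> where "\<delta> = \<delta>0 / 3"
  have \<delta>: "0 < \<delta>" "cball q (2 * \<delta>) \<subseteq> W" using \<delta>0 by (auto simp: \<delta>_def)
  obtain \<Theta> \<Theta>' where \<Theta>: "homeomorphism UNIV UNIV \<Theta> \<Theta>'" "\<And>x. x \<in> \<A> \<Longrightarrow> \<Theta> (e x) \<in> ball q \<delta>"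
    "\<And>z. z \<notin> W \<Longrightarrow> \<Theta> z = z"
  proof (rule squeeze_into_ball[OF cA \<open>\<A> \<noteq> {}\<close> e(1,3) Pe, of "\<lambda>t x. P (g (H t x))" q W \<delta>])
    show "continuous_on ({0..1} \<times> \<A>) (\<lambda>(t, x). P (g (H t x)))"
      using continuous_on_compose2[OF contPg H(1)] by (simp add: case_prod_unfold)
    show "P (g (H 0 x)) = e x" if "x \<in> \<A>" for x using that H(2) g(2) Pe by simp
    show "P (g (H 1 x)) = q" for x using H(3) g(2) Pe p by (simp add: q_def)
    show "P (g (H t x)) \<in> W" if "0 \<le> t" "t \<le> 1" "x \<in> \<A>" for t x
      using H(4)[OF that] by (simp add: U_def)
  qed (use P_P oW \<delta> in auto)
  obtain C where C: "\<And>z. norm (\<Theta> z) \<le> norm z + C" "\<And>z. z \<in> W \<Longrightarrow> \<Theta> z \<in> W" "\<And>z. z \<in> W \<Longrightarrow> \<Theta>' z \<in> W"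
    "\<And>z. norm (\<Theta>' z) \<le> norm z + C"
    using bounded_displacement[OF \<Theta>(1) \<open>bounded W\<close> \<Theta>(3)] by blast
  obtain bN' where bN': "0 < bN'" "\<And>z. z \<in> N \<Longrightarrow> norm z \<le> bN'" using bN unfolding bounded_pos by blast
  \<comment> \<open>\<open>D\<close> bounds all the additive errors at once, and
    \<open>18 * D\<close> is what remains after four times the estimate
    \<open>(norm z + 2 * D) / 4 + 4 * D\<close> for \<open>norm (f z)\<close>.\<close>
  define D where "D = \<bar>C\<bar> + \<bar>C0\<bar> + norm q + \<delta>"
  define R where "R = bN' + 18 * D"
  have D: "0 < D" "C \<le> D" "C0 \<le> D" "norm q \<le> D" "\<delta> \<le> D"
    unfolding D_def using \<delta>(1) norm_ge_zero[of q] by linarith+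
  have R: "0 < R" "bN' \<le> R" "18 * D \<le> R" using D bN' by (auto simp: R_def)
  \<comment> \<open>The bound \<open>1/4\<close> gives the halving outside the ball of radius
    \<open>R\<close>; the other bound makes \<open>\<psi>\<close> send the image of that ball under
    \<open>\<Theta>\<close> into \<open>cball q (2 * \<delta>)\<close>, inside
    \<open>W\<close>.\<close>
  define \<kappa> where "\<kappa> = min (1/4) (\<delta> / (R + 2 * D))"
  have \<kappa>: "0 < \<kappa>" "\<kappa> \<le> 1/4" "\<kappa> * (R + 2 * D) \<le> \<delta>"
  proof -
    show "0 < \<kappa>" using \<delta> R D by (simp add: \<kappa>_def)
    show "\<kappa> \<le> 1/4" unfolding \<kappa>_def by (rule min.cobounded1)
    have "\<kappa> \<le> \<delta> / (R + 2 * D)" unfolding \<kappa>_def by (rule min.cobounded2)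
    then have "\<kappa> * (R + 2 * D) \<le> \<delta> / (R + 2 * D) * (R + 2 * D)"
      using R D by (intro mult_right_mono) auto
    then show "\<kappa> * (R + 2 * D) \<le> \<delta>" using R D by simp
  qed
  obtain \<psi> \<psi>' where \<psi>: "homeomorphism UNIV UNIV \<psi> \<psi>'" "\<And>z. z \<in> cball q \<delta> \<Longrightarrow> \<psi> z = z"
    "\<And>z. dist q (\<psi> z) \<le> \<kappa> * dist q z + \<delta>"
    by (rule contraction_towards_ball[of \<kappa> \<delta> q]) (use \<kappa> \<delta> in auto)
  have TT: "\<Theta>' (\<Theta> z) = z" for z using \<Theta>(1) by (auto simp: homeomorphism_def)
  define f where "f = \<phi> \<circ> (\<Theta>' \<circ> (\<psi> \<circ> \<Theta>))"
  define f' where "f' = ((\<Theta>' \<circ> \<psi>') \<circ> \<Theta>) \<circ> \<phi>'"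
  have hf: "homeomorphism UNIV UNIV f f'"
    unfolding f_def f'_def
    by (rule homeomorphism_compose[OF homeomorphism_compose[OF homeomorphism_compose[OF \<Theta>(1) \<psi>(1)] homeomorphism_symD[OF \<Theta>(1)]] \<phi>(1)])
  have f\<phi>: "f a = \<phi> a" if a: "a \<in> A" for a
  proof -
    \<comment> \<open>\<open>\<psi>\<close> is the identity where \<open>\<Theta>\<close> places
      \<open>A\<close>, so \<open>\<Theta>\<close> and its inverse cancel.\<close>
    have "\<Theta> a \<in> cball q \<delta>" using a \<Theta>(2) less_imp_le by (force simp: A_def)
    then show ?thesis using \<psi>(2) TT by (simp add: f_def)
  qed
  then have fA: "f ` A = A" using \<phi>A by (metis image_cong)
  have conj: "F x = e' (f (e x))" if x: "x \<in> \<A>" for x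
  proof -
    have "e x \<in> A" "F x \<in> \<A>" using x FA by (auto simp: A_def)
    then show ?thesis using f\<phi> \<phi>e[OF x] e'e by simp
  qed
  have dq: "dist q (\<Theta> z) \<le> norm z + 2 * D" for z
    using C(1)[of z] D norm_triangle_ineq4[of q "\<Theta> z"] by (simp add: dist_norm)
  have inN: "f z \<in> N" if "norm z \<le> R" for z
  proof -
    have "\<kappa> * dist q (\<Theta> z) \<le> \<kappa> * (R + 2 * D)"
      using dq[of z] that \<kappa> by (intro mult_left_mono) auto
    then have "dist q (\<psi> (\<Theta> z)) \<le> 2 * \<delta>" using \<psi>(3)[of "\<Theta> z"] \<kappa>(3) by linarith
    then have "\<psi> (\<Theta> z) \<in> W" using \<delta>(2) by auto
    then have "\<Theta>' (\<psi> (\<Theta> z)) \<in> W" by (rule C(3))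
    then show ?thesis by (simp add: f_def W_def)
  qed
  have half: "norm (f z) \<le> norm z / 2" if "R < norm z" for z
  proof -
    have "\<kappa> * dist q (\<Theta> z) \<le> 1/4 * (norm z + 2 * D)"
      using dq[of z] \<kappa> D by (intro mult_mono) auto
    then have "dist q (\<psi> (\<Theta> z)) \<le> 1/4 * (norm z + 2 * D) + D" using \<psi>(3)[of "\<Theta> z"] D by linarith
    moreover have "norm (\<psi> (\<Theta> z)) \<le> norm q + dist q (\<psi> (\<Theta> z))"
      using norm_triangle_sub[of "\<psi> (\<Theta> z)" q] by (simp add: dist_norm norm_minus_commute)
    moreover have "norm (f z) \<le> norm (\<psi> (\<Theta> z)) + C + C0"
      using C(4)[of "\<psi> (\<Theta> z)"] \<phi>(3)[of "\<Theta>' (\<psi> (\<Theta> z))"] by (simp add: f_def)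
    ultimately have "norm (f z) \<le> 1/4 * (norm z + 2 * D) + 4 * D" using D by linarith
    then have "4 * norm (f z) \<le> norm z + 18 * D" by (simp add: field_simps)
    also have "\<dots> \<le> norm z + norm z" using that R(3) by simp
    finally show ?thesis by simp
  qed
  have AR: "A \<subseteq> cball 0 R" using bN'(2) AN R(2) by force
  have ballR: "f ` cball 0 R \<subseteq> cball 0 R" using inN bN'(2) R(2) by force
  obtain Af where Af: "global_attractor f Af" "A \<subseteq> Af" "Af \<subseteq> f ` cball 0 R"
    by (rule absorbing_ball_attractor[OF hf R(1) half ballR fA AR])
  have "Af \<subseteq> nbhd A \<epsilon>" using Af(3) inN by (force simp: N_def nbhd_def)
  then show ?thesis using e' hf fA conj Af by blast
qed

end

section \<open>Realisation in coordinates\<close>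

text \<open>\<open>P\<close> keeps the coordinates in a set \<open>I\<close> of half the indices and
  \<open>\<sigma>\<close> permutes coordinates by an involution exchanging \<open>I\<close> with its
  complement; this makes \<open>\<sigma>\<close> an isometry that interchanges the factors.\<close>

lemma ex_swapped_splitting:
  assumes "CARD('n::finite) = 2 * d"
  obtains P \<sigma> :: "real ^ 'n \<Rightarrow> real ^ 'n" where "swapped_splitting P \<sigma>" "dim (range P) = d"
proof -
  obtain I :: "'n set" where I: "card I = d"
    using obtain_subset_with_card_n[of d "UNIV :: 'n set"] assms by auto
  have "card (- I) = d" using I assms card_Diff_subset[of I UNIV] by (simp add: Compl_eq_Diff_UNIV)
  then obtain b where b: "bij_betw b I (- I)"
    using I finite_same_card_bij[of I "- I"] by auto
  define \<pi> where "\<pi> i = (if i \<in> I then b i else inv_into I b i)" for i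
  have \<pi>I: "\<pi> i \<in> I \<longleftrightarrow> i \<notin> I" for i
    using b by (auto simp: \<pi>_def bij_betw_def inv_into_into)
  have \<pi>\<pi>: "\<pi> (\<pi> i) = i" for i
  proof (cases "i \<in> I")
    case True
    then show ?thesis using \<pi>I[of i] b by (simp add: \<pi>_def bij_betw_inv_into_left)
  next
    case False
    then show ?thesis using \<pi>I[of i] b by (simp add: \<pi>_def bij_betw_inv_into_right)
  qed
  define P :: "real ^ 'n \<Rightarrow> real ^ 'n" where "P z = (\<chi> i. if i \<in> I then z $ i else 0)" for z
  define \<sigma> :: "real ^ 'n \<Rightarrow> real ^ 'n" where "\<sigma> z = (\<chi> i. z $ \<pi> i)" for z
  have "swapped_splitting P \<sigma>"
  proof (rule swapped_splitting.intro)
    show "linear P" by (rule linearI) (auto simp: P_def vec_eq_iff)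
    show "linear \<sigma>" by (rule linearI) (auto simp: \<sigma>_def vec_eq_iff)
    show "P (P z) = P z" for z by (auto simp: P_def vec_eq_iff)
    show "norm (P z) \<le> norm z" for z
      by (rule norm_le_componentwise_cart) (auto simp: P_def)
    show "norm (z - P z) \<le> norm z" for z
      by (rule norm_le_componentwise_cart) (auto simp: P_def)
    show "\<sigma> (\<sigma> z) = z" for z by (auto simp: \<sigma>_def vec_eq_iff \<pi>\<pi>)
    show "norm (\<sigma> z) = norm z" for z
    proof -
      have "bij \<pi>" using \<pi>\<pi> by (rule involuntory_imp_bij)
      then have "(\<Sum>i\<in>UNIV. (norm (z $ \<pi> i))\<^sup>2) = (\<Sum>i\<in>UNIV. (norm (z $ i))\<^sup>2)"
        by (rule sum.reindex_bij_betw)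
      then show ?thesis by (simp add: norm_vec_def L2_set_def \<sigma>_def)
    qed
    show "\<sigma> (P z) = \<sigma> z - P (\<sigma> z)" for z by (auto simp: \<sigma>_def P_def vec_eq_iff \<pi>I)
  qed
  moreover have "dim (range P) = d"
  proof -
    have "range P = {z :: real ^ 'n. \<forall>i. i \<notin> I \<longrightarrow> z $ i = 0}"
    proof (intro equalityI subsetI)
      fix z :: "real ^ 'n" assume "z \<in> {z. \<forall>i. i \<notin> I \<longrightarrow> z $ i = 0}"
      then have "z = P z" by (auto simp: P_def vec_eq_iff)
      then show "z \<in> range P" by blast
    qed (auto simp: P_def)
    then show ?thesis using I dim_substandard_cart[of I] by (simp add: dim_vec_eq[symmetric])
  qed
  ultimately show ?thesis by (rule that)
qed

theorem theorem6p1: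
  fixes F F' :: "'a::real_normed_vector \<Rightarrow> 'a"
    and \<A> :: "'a set"
    and k :: nat
    and \<epsilon> :: real
  assumes "homeomorphism UNIV UNIV F F'"
    and "global_attractor F \<A>"
    and "covering_dim (top_of_set \<A>) \<le> ereal (real k)"
    and "CARD('n::finite) = 4 * k + 4"
    and "\<epsilon> > 0"
  shows "\<exists>(A :: (real ^ 'n) set) (e :: 'a \<Rightarrow> real ^ 'n) e' (f :: real ^ 'n \<Rightarrow> real ^ 'n) f' A\<^sub>f.
           homeomorphism \<A> A e e' \<and>
           homeomorphism UNIV UNIV f f' \<and>
           f ` A = A \<and>
           (\<forall>x\<in>\<A>. F x = e' (f (e x))) \<and>
           global_attractor f A\<^sub>f \<and>
           A \<subseteq> A\<^sub>f \<and> A\<^sub>f \<subseteq> nbhd A \<epsilon>"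
proof -
  \<comment> \<open>Each of the two factors gets dimension \<open>2 * k + 2\<close>, twice the cover
    order \<open>k + 1\<close>.\<close>
  have "CARD('n) = 2 * (2 * k + 2)" using assms(4) by simp
  then obtain P \<sigma> :: "real ^ 'n \<Rightarrow> real ^ 'n"
    where P: "swapped_splitting P \<sigma>" "dim (range P) = 2 * k + 2"
    by (rule ex_swapped_splitting)
  show ?thesis
    using P(2) by (intro swapped_splitting.embedded_dynamics_near_attractor[OF P(1) assms(1-3) _ assms(5)]) simp
qed

end
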